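(* Let $\Gamma$ be a finite group of order $k\ge 2$. Let $D$ be an Eulerian digraph with an edge-labelling $w:E(D)\to\Gamma$, and write $d(v):=d^+(v)=d^-(v)$, $\delta:=\min_v d(v)$ and $\Delta:=\max_v d(v)$. If $\Delta>0$ and $$\frac{\delta^3}{\Delta^2}\ge e^3(k-1),$$ where $e$ is the base of the natural logarithm, then $D$ contains a zero-sum directed cycle.
   Context: All digraphs are finite, nonempty, simple and loopless: for each ordered pair $(u,v)$ there is at most one edge from $u$ to $v$, there are no edges from a vertex to itself, and both opposite edges $uv$ and $vu$ may be present. $d^+(v)$ and $d^-(v)$ denote the outdegree and indegree of $v$. A digraph is Eulerian if $d^+(v)=d^-(v)$ for every vertex $v$ (connectivity is not required). A directed cycle $C=v_1v_2\cdots v_\ell v_1$ has distinct vertices $v_1,\dots,v_\ell$ and all displayed edges in $D$ (so $\ell\ge 2$); cycles differing by cyclic rotation are the same. $\Gamma$ is written multiplicatively with identity $1_\Gamma$ and need not be abelian. The ordered label product of $C$ is $w(C)=w(v_1v_2)w(v_2v_3)\cdots w(v_\ell v_1)$; $C$ is zero-sum if $w(C)=1_\Gamma$ (independent of the choice of initial vertex). *)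

theory Defs
  imports Complex_Main "HOL-Algebra.Group" "HOL-Algebra.Coset" "Graph_Theory.Arc_Walk"
begin

text \<open>Connectivity is not part of the notion.\<close>

definition eulerian :: "('a, 'b) pre_digraph \<Rightarrow> bool" where
  "eulerian D \<longleftrightarrow> (\<forall>v\<in>verts D. out_degree D v = in_degree D v)"

text \<open>
  The next two are meant for Eulerian digraphs, where outdegree and indegree agree. They are
  meaningful only if the vertex set is finite and nonempty.
\<close>

definition min_deg :: "('a, 'b) pre_digraph \<Rightarrow> nat" where
  "min_deg D = Min (out_degree D ` verts D)"

definition max_deg :: "('a, 'b) pre_digraph \<Rightarrow> nat" where
  "max_deg D = Max (out_degree D ` verts D)"

text \<open>The group need not be abelian, so the factors are multiplied in the order of the list.\<close>

definition label_product :: "('g, 'm) monoid_scheme \<Rightarrow> ('b \<Rightarrow> 'g) \<Rightarrow> 'b list \<Rightarrow> 'g" where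
  "label_product \<Gamma> w p = foldr (mult \<Gamma>) (map w p) (one \<Gamma>)"

text \<open>
  A cycle is given by its list of consecutive arcs from some initial vertex. Since
  \<open>pre_digraph.cycle\<close> forces the vertices to be distinct, such lists in a loopfree digraph have
  length at least 2. Different initial vertices give conjugate label products.
\<close>

definition zero_sum_cycle ::
  "('g, 'm) monoid_scheme \<Rightarrow> ('a, 'b) pre_digraph \<Rightarrow> ('b \<Rightarrow> 'g) \<Rightarrow> 'b list \<Rightarrow> bool" where
  "zero_sum_cycle \<Gamma> D w p \<longleftrightarrow>
     pre_digraph.cycle D p \<and> label_product \<Gamma> w p = one \<Gamma>"

end

theory Submission
  imports Defs "HOL-Analysis.Analysis" "HOL-Computational_Algebra.Fundamental_Theorem_Algebra"
    "HOL-Combinatorics.Permutations" "Jordan_Normal_Form.Determinant"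
begin

text \<open>
  Let \<open>a\<close> be the adjacency matrix. If no cycle is zero-sum, every permutation \<open>p\<close> of a vertex set \<open>S\<close>
  along the arcs satisfies
  \<open>(\<Sum>h:S\<rightarrow>\<Gamma>. \<Prod>u\<in>S. [h (p u) = h u w(u, p u)] - 1/k) = (-1) ^ card S * sign p\<close>:
  the left side is the product over the cycles of \<open>p\<close> of the character of the regular representation
  minus the trivial one, which is \<open>-1\<close> off the identity. Hence the permanent of \<open>a\<close> on \<open>S\<close> is, up to
  sign, a sum over \<open>h\<close> of determinants. Hadamard's inequality, Cauchy-Schwarz and the independence of the
  events \<open>h (f u) = h u w(u, f u)\<close> along forests bound it by the product of the \<open>sqrt ((k - 1) d u)\<close>.

  In the other direction, Gurvits' capacity argument for stable polynomials, applied to \<open>a\<close> plus a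
  diagonal matrix, shows that the permanent of \<open>a + diag c\<close> is at least the product of the \<open>d u / e\<close>
  as soon as \<open>c u \<ge> (1 - d u / \<Delta>) d u / e\<close>. The diagonal is needed because \<open>a\<close> itself may have
  permanent zero. Expanding along the diagonal contradicts the upper bound.
\<close>

text \<open>The obstacle is that \<open>D\<close> need not be regular and that passing to a subset
  of the vertices loses outdegree, so the permanent of \<open>a\<close> on a subset has no useful
  lower bound. It does have an upper bound on every subset, and this is all that the expansion along
  the diagonal asks for.

  Size of the diagonal: row and column sums of \<open>a\<close> agree because \<open>D\<close> is
  Eulerian, so \<open>a / \<Delta>\<close> together with the diagonal entries
  \<open>1 - d u / \<Delta>\<close> is doubly stochastic.

  Origin of the hypothesis: with the upper bound \<open>R u = sqrt ((k - 1) d u)\<close> per vertex,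
  the expansion sums up to the product of the \<open>c u + R u\<close>. The contradiction is
  therefore local: one needs \<open>c u + R u < d u / e\<close> for an admissible
  \<open>c u\<close>, which amounts to \<open>R u < (d u)^2 / (\<Delta> e)\<close>, or
  \<open>e^2 (k - 1) \<Delta>^2 < (d u)^3\<close>.

  Origin of the sign: a cycle of length \<open>l\<close> contributes -1, which is
  \<open>(-1)^l\<close> times its sign as a permutation. This sign is what turns the permanent into
  determinants.\<close>

hide_const (open) Polynomial.order

section \<open>Complex polynomials with restricted roots\<close>

text \<open>The Gauss-Lucas argument at the point 0: the quotient \<open>P'(0) / P(0)\<close> is the
  sum of the \<open>1 / (- r i)\<close>, all of which lie in the open lower half plane.\<close>

lemma pderiv_0_neq_0_if_roots_lower_half_plane:
  fixes P :: "complex poly"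
  assumes "degree P > 0" and roots: "\<And>s. poly P s = 0 \<Longrightarrow> Im s < 0"
  shows "poly (pderiv P) 0 \<noteq> 0"
proof -
  obtain r where P: "Polynomial.smult (lead_coeff P) (\<Prod>i<degree P. [:- r i, 1:]) = P"
    by (rule complex_poly_decompose')
  let ?n = "degree P"
  have lc: "lead_coeff P \<noteq> 0" using assms(1) by auto
  have "poly P (r i) = 0" if "i < ?n" for i
    using that by (subst P[symmetric]) (auto simp: poly_prod)
  then have neg: "Im (r i) < 0" if "i < ?n" for i using roots that by blast
  then have nz: "r i \<noteq> 0" if "i < ?n" for i using that by force
  have "poly (pderiv P) 0 = lead_coeff P * (\<Sum>i<?n. \<Prod>j\<in>{..<?n}-{i}. - r j)"
    by (subst P[symmetric], simp add: pderiv_smult pderiv_prod poly_sum poly_prod pderiv_pCons)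
  also have "(\<Sum>i<?n. \<Prod>j\<in>{..<?n}-{i}. - r j) = (\<Prod>j<?n. - r j) * (\<Sum>i<?n. 1 / (- r i))"
    unfolding sum_distrib_left
    by (intro sum.cong refl, subst prod.remove[of "{..<?n}"]) (auto simp: nz)
  finally have eq: "poly (pderiv P) 0 = lead_coeff P * ((\<Prod>j<?n. - r j) * (\<Sum>i<?n. 1 / (- r i)))" .
  have "Im (1 / (- r i)) < 0" if "i < ?n" for i
  proof -
    have "Im (1 / (- r i)) = Im (r i) / ((Re (r i))\<^sup>2 + (Im (r i))\<^sup>2)"
      by (simp add: Im_divide)
    then show ?thesis using neg[OF that]
      by (simp add: divide_neg_pos sum_power2_gt_zero_iff)
  qed
  then have "(\<Sum>i<?n. Im (1 / (- r i))) < 0"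
    using assms(1) sum_strict_mono[of "{..<?n}" "\<lambda>i. Im (1 / (- r i))" "\<lambda>_. 0"] by auto
  then have "(\<Sum>i<?n. 1 / (- r i)) \<noteq> 0" by (metis Im_sum less_irrefl zero_complex.simps(2))
  then show ?thesis using eq lc nz by auto
qed

text \<open>Moving from 0 perpendicularly to the real axis increases the distance to every real
  root.\<close>

lemma norm_poly_0_le_if_roots_real:
  fixes P :: "complex poly"
  assumes "\<And>s. poly P s = 0 \<Longrightarrow> Im s = 0"
  shows "norm (poly P 0) \<le> norm (poly P (- \<i>))"
proof -
  obtain r where P: "Polynomial.smult (lead_coeff P) (\<Prod>i<degree P. [:- r i, 1:]) = P"
    by (rule complex_poly_decompose')
  let ?n = "degree P"
  show ?thesis
  proof (cases "P = 0")
    case False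
    have "poly P (r i) = 0" if "i < ?n" for i
      using that by (subst P[symmetric]) (auto simp: poly_prod)
    then have re: "Im (r i) = 0" if "i < ?n" for i using assms that by blast
    have "norm (- r i) \<le> norm (- \<i> - r i)" if "i < ?n" for i
      using re[OF that] by (simp add: cmod_def real_le_rsqrt)
    then have "(\<Prod>i<?n. norm (- r i)) \<le> (\<Prod>i<?n. norm (- \<i> - r i))"
      by (intro prod_mono) auto
    moreover have "norm (poly P x) = norm (lead_coeff P) * (\<Prod>i<?n. norm (x - r i))" for x
      by (subst P[symmetric]) (simp add: poly_prod norm_mult prod_norm)
    ultimately show ?thesis by (simp add: mult_left_mono)
  qed auto
qed

text \<open>With roots \<open>- t i\<close> the polynomial is \<open>p0\<close> times the product of
  the \<open>1 + y / t i\<close>, and the sum of the \<open>1 / t i\<close> is the logarithmic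
  derivative \<open>p1 / p0\<close>; then \<open>1 + x \<le> exp x\<close> is applied to each
  factor.\<close>

lemma poly_le_exp_if_roots_negative:
  fixes P :: "complex poly"
  assumes roots: "\<And>s. poly P s = 0 \<Longrightarrow> Im s = 0 \<and> Re s < 0"
    and P0: "poly P 0 = of_real p0" "p0 > 0" and P1: "poly (pderiv P) 0 = of_real p1"
    and y: "y \<ge> 0"
  shows "Re (poly P (of_real y)) \<le> p0 * exp (y * p1 / p0)"
proof -
  obtain r where P: "Polynomial.smult (lead_coeff P) (\<Prod>i<degree P. [:- r i, 1:]) = P"
    by (rule complex_poly_decompose')
  let ?n = "degree P"
  have "poly P (r i) = 0" if "i < ?n" for i
    using that by (subst P[symmetric]) (auto simp: poly_prod)
  then have rr: "Im (r i) = 0 \<and> Re (r i) < 0" if "i < ?n" for i using roots that by blast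
  define t where "t i = - Re (r i)" for i
  have t: "t i > 0" "r i = - of_real (t i)" if "i < ?n" for i
    using rr[OF that] by (auto simp: t_def complex_eq_iff)
  have ev: "poly P x = lead_coeff P * (\<Prod>i<?n. of_real (t i) + x)" for x
    by (subst P[symmetric]) (simp add: poly_prod t)
  have lc: "lead_coeff P * (\<Prod>i<?n. of_real (t i)) = of_real p0"
    using ev[of 0] P0 by simp
  have "poly (pderiv P) 0 = lead_coeff P * (\<Sum>i<?n. \<Prod>j\<in>{..<?n}-{i}. of_real (t j))"
    by (subst P[symmetric], simp add: pderiv_smult pderiv_prod poly_sum poly_prod pderiv_pCons t)
  also have "(\<Sum>i<?n. \<Prod>j\<in>{..<?n}-{i}. (of_real (t j) :: complex))
      = (\<Prod>j<?n. of_real (t j)) * (\<Sum>i<?n. of_real (1 / t i))"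
    unfolding sum_distrib_left
  proof (intro sum.cong refl)
    fix i assume i: "i \<in> {..<?n}"
    have "(\<Prod>j<?n. complex_of_real (t j))
        = complex_of_real (t i) * (\<Prod>j\<in>{..<?n}-{i}. complex_of_real (t j))"
      using i by (intro prod.remove) auto
    then show "(\<Prod>j\<in>{..<?n}-{i}. complex_of_real (t j))
        = (\<Prod>j<?n. complex_of_real (t j)) * complex_of_real (1 / t i)"
      using i t(1)[of i] by simp
  qed
  finally have "of_real p1 = of_real p0 * (\<Sum>i<?n. complex_of_real (1 / t i))"
    unfolding P1 mult.assoc[symmetric] lc .
  then have p1: "p1 = p0 * (\<Sum>i<?n. 1 / t i)"
    by (metis (mono_tags, lifting) of_real_eq_iff of_real_mult of_real_sum sum.cong)
  have "poly P (of_real y) = of_real p0 * (\<Prod>i<?n. of_real (1 + y / t i))"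
    unfolding ev lc[symmetric] mult.assoc prod.distrib[symmetric]
  proof (intro arg_cong[where f = "(*) (lead_coeff P)"] prod.cong refl)
    fix i assume "i \<in> {..<?n}"
    then have "t i \<noteq> 0" using t(1)[of i] by auto
    then show "complex_of_real (t i) + complex_of_real y
        = complex_of_real (t i) * complex_of_real (1 + y / t i)"
      unfolding of_real_mult[symmetric] of_real_add[symmetric] by (simp add: field_simps)
  qed
  then have "Re (poly P (of_real y)) = p0 * (\<Prod>i<?n. 1 + y / t i)"
    by (simp only: of_real_prod[symmetric] of_real_mult[symmetric] Re_complex_of_real)
  also have "(\<Prod>i<?n. 1 + y / t i) \<le> (\<Prod>i<?n. exp (y / t i))"
    using y t by (intro prod_mono conjI) (auto simp: less_imp_le exp_ge_add_one_self)
  also have "\<dots> = exp (y * p1 / p0)"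
  proof -
    have "y * p1 / p0 = y * (\<Sum>i<?n. 1 / t i)" unfolding p1 using P0(2) by simp
    then have "y * p1 / p0 = (\<Sum>i<?n. y / t i)" by (simp add: sum_distrib_left)
    then show ?thesis by (simp add: exp_sum)
  qed
  finally show ?thesis using P0 by simp
qed

section \<open>Multiaffine polynomials\<close>

text \<open>The codomain is left open so that the same real coefficients can be evaluated at real
  and at complex points.\<close>

definition multiaff :: "'a set \<Rightarrow> ('a set \<Rightarrow> real) \<Rightarrow> ('a \<Rightarrow> 'b) \<Rightarrow> 'b::{real_algebra_1,comm_ring_1}" where
  "multiaff V c z = (\<Sum>U\<in>Pow V. of_real (c U) * (\<Prod>u\<in>U. z u))"

text \<open>Coefficients of the derivative in direction \<open>d\<close>: the monomial
  \<open>U\<close> arises from \<open>insert u U\<close> by removing the variable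
  \<open>u\<close>.\<close>

definition dir_deriv :: "'a set \<Rightarrow> ('a \<Rightarrow> real) \<Rightarrow> ('a set \<Rightarrow> real) \<Rightarrow> 'a set \<Rightarrow> real" where
  "dir_deriv V d c U = (\<Sum>u\<in>V - U. d u * c (insert u U))"

definition multiaff_line :: "'a set \<Rightarrow> ('a set \<Rightarrow> real) \<Rightarrow> ('a \<Rightarrow> complex) \<Rightarrow> ('a \<Rightarrow> real) \<Rightarrow> complex poly" where
  "multiaff_line V c z d = (\<Sum>U\<in>Pow V. Polynomial.smult (of_real (c U)) (\<Prod>u\<in>U. [:z u, of_real (d u):]))"

definition nonneg_homog :: "'a set \<Rightarrow> nat \<Rightarrow> ('a set \<Rightarrow> real) \<Rightarrow> bool" where
  "nonneg_homog V k c \<longleftrightarrow> (\<forall>U\<subseteq>V. 0 \<le> c U \<and> (c U \<noteq> 0 \<longrightarrow> card U = k))"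

text \<open>For polynomials with nonnegative coefficients this implies that there is no zero in the
  product of open upper half planes; unlike the latter property it survives on the boundary.\<close>
definition strongly_stable :: "'a set \<Rightarrow> ('a set \<Rightarrow> real) \<Rightarrow> bool" where
  "strongly_stable V c \<longleftrightarrow>
     (\<forall>z::'a \<Rightarrow> complex. (\<forall>u\<in>V. 0 \<le> Im (z u)) \<longrightarrow> multiaff V c (\<lambda>u. Im (z u)) \<le> norm (multiaff V c z))"

lemma multiaff_of_real: "multiaff V c (\<lambda>u. complex_of_real (z u)) = of_real (multiaff V c z)"
  by (simp add: multiaff_def)

lemma multiaff_cong: "(\<And>u. u \<in> V \<Longrightarrow> z u = z' u) \<Longrightarrow> multiaff V c z = multiaff V c z'"
  unfolding multiaff_def by (intro sum.cong refl arg_cong2[where f = "(*)"] prod.cong) auto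

lemma poly_multiaff_line: "poly (multiaff_line V c z d) s = multiaff V c (\<lambda>u. z u + s * of_real (d u))"
  by (simp add: multiaff_line_def multiaff_def poly_sum poly_prod)

lemma multiaff_dir_deriv:
  assumes "finite V"
  shows "multiaff V (dir_deriv V d c) z
    = (\<Sum>U\<in>Pow V. of_real (c U) * (\<Sum>u\<in>U. of_real (d u) * (\<Prod>w\<in>U - {u}. z w)))"
proof -
  have fin: "finite (Pow V)" "\<And>U. U \<in> Pow V \<Longrightarrow> finite U"
    using assms by (auto intro: finite_subset)
  let ?g = "\<lambda>U u. of_real (c U) * (of_real (d u) * (\<Prod>w\<in>U - {u}. z w))"
  have "multiaff V (dir_deriv V d c) z
      = (\<Sum>U\<in>Pow V. \<Sum>u\<in>V - U. ?g (insert u U) u)"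
    unfolding multiaff_def dir_deriv_def of_real_sum sum_distrib_right
    by (intro sum.cong refl) (auto simp: mult_ac)
  also have "\<dots> = (\<Sum>(U, u)\<in>(SIGMA U:Pow V. V - U). ?g (insert u U) u)"
    using assms by (subst sum.Sigma) auto
  also have "\<dots> = (\<Sum>(U, u)\<in>(SIGMA U:Pow V. U). ?g U u)"
    by (rule sum.reindex_bij_witness[of _ "\<lambda>(U, u). (U - {u}, u)" "\<lambda>(U, u). (insert u U, u)"]) auto
  also have "\<dots> = (\<Sum>U\<in>Pow V. \<Sum>u\<in>U. ?g U u)"
    using assms fin by (subst sum.Sigma) auto
  finally show ?thesis by (simp add: sum_distrib_left)
qed

lemma pderiv_finite_sum: "pderiv (\<Sum>x\<in>A. f x) = (\<Sum>x\<in>A. pderiv (f x))"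
  by (induction A rule: infinite_finite_induct) (simp_all add: pderiv_add)

lemma pderiv_multiaff_line:
  assumes "finite V"
  shows "poly (pderiv (multiaff_line V c z d)) 0 = multiaff V (dir_deriv V d c) z"
  unfolding multiaff_line_def multiaff_dir_deriv[OF assms]
  by (simp add: pderiv_finite_sum pderiv_smult pderiv_prod poly_sum poly_prod pderiv_pCons
      sum_distrib_left mult_ac)

lemma nonneg_homog_dir_deriv:
  assumes "finite V" "nonneg_homog V (Suc k) c" "\<And>u. u \<in> V \<Longrightarrow> 0 \<le> d u"
  shows "nonneg_homog V k (dir_deriv V d c)"
  unfolding nonneg_homog_def
proof (intro allI impI conjI)
  fix U assume U: "U \<subseteq> V"
  show "0 \<le> dir_deriv V d c U"
    unfolding dir_deriv_def using assms U by (intro sum_nonneg) (auto simp: nonneg_homog_def)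
  assume "dir_deriv V d c U \<noteq> 0"
  then obtain u where "u \<in> V - U" "c (insert u U) \<noteq> 0"
    unfolding dir_deriv_def by (metis (no_types, lifting) mult_eq_0_iff sum.neutral)
  then have "card (insert u U) = Suc k" "u \<notin> U"
    using assms(2) U unfolding nonneg_homog_def by auto
  then show "card U = k" using finite_subset[OF U assms(1)] by simp
qed

lemma multiaff_scale:
  assumes "nonneg_homog V k c"
  shows "multiaff V c (\<lambda>u. t * z u) = t ^ k * multiaff V c z"
  unfolding multiaff_def sum_distrib_left
proof (intro sum.cong refl)
  fix U assume "U \<in> Pow V"
  then show "of_real (c U) * (\<Prod>u\<in>U. t * z u) = t ^ k * (of_real (c U) * (\<Prod>u\<in>U. z u))"
    using assms by (cases "c U = 0") (auto simp: nonneg_homog_def prod.distrib mult_ac)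
qed

lemma multiaff_mono:
  fixes z z' :: "'a \<Rightarrow> real"
  assumes "nonneg_homog V k c" "\<And>u. u \<in> V \<Longrightarrow> 0 \<le> z u" "\<And>u. u \<in> V \<Longrightarrow> z u \<le> z' u"
  shows "multiaff V c z \<le> multiaff V c z'"
  unfolding multiaff_def using assms
  by (intro sum_mono mult_left_mono prod_mono) (auto simp: nonneg_homog_def)

lemma multiaff_nonneg:
  fixes z :: "'a \<Rightarrow> real"
  assumes "nonneg_homog V k c" "\<And>u. u \<in> V \<Longrightarrow> 0 \<le> z u"
  shows "0 \<le> multiaff V c z"
  unfolding multiaff_def using assms
  by (intro sum_nonneg mult_nonneg_nonneg prod_nonneg) (auto simp: nonneg_homog_def)

lemma multiaff_pos:
  fixes z :: "'a \<Rightarrow> real"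
  assumes "finite V" "nonneg_homog V k c" "\<And>u. u \<in> V \<Longrightarrow> 0 \<le> z u" "\<And>u. u \<in> U \<Longrightarrow> 0 < z u"
    "U \<subseteq> V" "c U \<noteq> 0"
  shows "0 < multiaff V c z"
  unfolding multiaff_def
proof (rule sum_pos2[of _ U])
  show "finite (Pow V)" "U \<in> Pow V" using assms by auto
  have "0 < (\<Prod>u\<in>U. z u)" using assms(4) by (intro prod_pos) auto
  moreover have "0 < c U" using assms(2,5,6) by (auto simp: nonneg_homog_def order_less_le)
  ultimately show "0 < of_real (c U) * (\<Prod>u\<in>U. z u)" by simp
  show "0 \<le> of_real (c W) * (\<Prod>u\<in>W. z u)" if "W \<in> Pow V" for W
    using that assms(2,3) by (auto simp: nonneg_homog_def intro!: mult_nonneg_nonneg prod_nonneg)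
qed

lemma prod_add_ge_linear:
  fixes a d :: "'a \<Rightarrow> real"
  assumes "finite U" "\<And>u. u \<in> U \<Longrightarrow> 0 \<le> a u" "\<And>u. u \<in> U \<Longrightarrow> 0 \<le> d u"
  shows "(\<Prod>u\<in>U. a u) + (\<Sum>u\<in>U. d u * (\<Prod>w\<in>U - {u}. a w)) \<le> (\<Prod>u\<in>U. a u + d u)"
  using assms
proof (induction U)
  case (insert v U)
  have eq: "(\<Sum>u\<in>U. d u * (\<Prod>w\<in>insert v U - {u}. a w)) = a v * (\<Sum>u\<in>U. d u * (\<Prod>w\<in>U - {u}. a w))"
    unfolding sum_distrib_left
  proof (intro sum.cong refl)
    fix u assume "u \<in> U"
    then have "insert v U - {u} = insert v (U - {u})" "v \<notin> U - {u}" using insert by auto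
    then show "d u * (\<Prod>w\<in>insert v U - {u}. a w) = a v * (d u * (\<Prod>w\<in>U - {u}. a w))"
      using insert by simp
  qed
  have IH: "(\<Prod>u\<in>U. a u) + (\<Sum>u\<in>U. d u * (\<Prod>w\<in>U - {u}. a w)) \<le> (\<Prod>u\<in>U. a u + d u)"
    using insert.IH insert.prems by simp
  have "a v * ((\<Prod>u\<in>U. a u) + (\<Sum>u\<in>U. d u * (\<Prod>w\<in>U - {u}. a w))) \<le> a v * (\<Prod>u\<in>U. a u + d u)"
    using IH insert by (intro mult_left_mono) auto
  moreover have "d v * (\<Prod>u\<in>U. a u) \<le> d v * (\<Prod>u\<in>U. a u + d u)"
    using insert by (intro mult_left_mono prod_mono) auto
  ultimately show ?case using insert eq by (simp add: algebra_simps)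
qed simp

text \<open>All coefficients are nonnegative, so dropping the terms of order two and more in
  \<open>t\<close> only decreases the value. This serves to show that restrictions to lines are not
  constant.\<close>

lemma multiaff_add_ge_linear:
  fixes a d :: "'a \<Rightarrow> real"
  assumes "finite V" "nonneg_homog V k c" "\<And>u. u \<in> V \<Longrightarrow> 0 \<le> a u" "\<And>u. u \<in> V \<Longrightarrow> 0 \<le> d u" "0 \<le> t"
  shows "multiaff V c a + t * multiaff V (dir_deriv V d c) a \<le> multiaff V c (\<lambda>u. a u + t * d u)"
proof -
  have "multiaff V c a + t * multiaff V (dir_deriv V d c) a
      = (\<Sum>U\<in>Pow V. c U * ((\<Prod>u\<in>U. a u) + (\<Sum>u\<in>U. (t * d u) * (\<Prod>w\<in>U - {u}. a w))))"
    unfolding multiaff_dir_deriv[OF assms(1)]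
    by (simp add: multiaff_def sum_distrib_left sum.distrib distrib_left mult_ac)
  also have "\<dots> \<le> (\<Sum>U\<in>Pow V. c U * (\<Prod>u\<in>U. a u + t * d u))"
  proof (rule sum_mono)
    fix U assume "U \<in> Pow V"
    then have U: "finite U" "U \<subseteq> V" using assms(1) finite_subset by auto
    then have "(\<Prod>u\<in>U. a u) + (\<Sum>u\<in>U. (t * d u) * (\<Prod>w\<in>U - {u}. a w)) \<le> (\<Prod>u\<in>U. a u + t * d u)"
      using assms(3-5) by (intro prod_add_ge_linear) auto
    moreover have "0 \<le> c U" using assms(2) U by (simp add: nonneg_homog_def)
    ultimately show "c U * ((\<Prod>u\<in>U. a u) + (\<Sum>u\<in>U. (t * d u) * (\<Prod>w\<in>U - {u}. a w)))
        \<le> c U * (\<Prod>u\<in>U. a u + t * d u)" by (rule mult_left_mono)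
  qed
  finally show ?thesis by (simp add: multiaff_def)
qed


text \<open>Multiplying all variables by \<open>\<i>\<close> multiplies a homogeneous polynomial by
  a number of modulus 1.\<close>

lemma norm_multiaff_rotate:
  assumes "nonneg_homog V k c"
  shows "norm (multiaff V c (\<lambda>u. complex_of_real (a u) + (- \<i>) * of_real (b u)))
    = norm (multiaff V c (\<lambda>u. of_real (b u) + \<i> * of_real (a u)))"
proof -
  have "multiaff V c (\<lambda>u. of_real (b u) + \<i> * of_real (a u))
      = multiaff V c (\<lambda>u. \<i> * (complex_of_real (a u) + (- \<i>) * of_real (b u)))"
    by (simp add: algebra_simps)
  then show ?thesis unfolding multiaff_scale[OF assms] by (simp add: norm_mult norm_power)
qed

section \<open>Stability of multiaffine polynomials\<close>

lemma tendsto_multiaff_line: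
  fixes z :: "'a \<Rightarrow> 'b::real_normed_field"
  shows "((\<lambda>t. multiaff V c (\<lambda>u. z u + of_real t * z' u)) \<longlongrightarrow> multiaff V c z) (at_right 0)"
proof -
  have "((\<lambda>t. multiaff V c (\<lambda>u. z u + of_real t * z' u)) \<longlongrightarrow> multiaff V c (\<lambda>u. z u + of_real 0 * z' u)) (at_right 0)"
    unfolding multiaff_def by (intro tendsto_intros)
  then show ?thesis by simp
qed

text \<open>For \<open>z = b + \<i> a\<close> with \<open>a > 0\<close> the polynomial
  \<open>P(s) = f(a + s b)\<close> has only real roots, so
  \<open>f(a) = |P(0)| \<le> |P(- \<i>)|\<close>, and by rotation the right side is
  \<open>|f(z)|\<close>. Points with some \<open>Im (z u) = 0\<close> follow by a limit.\<close>

lemma strongly_stableI: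
  assumes fin: "finite V" and hom: "nonneg_homog V k c"
    and nz: "\<And>z::'a \<Rightarrow> complex. (\<And>u. u \<in> V \<Longrightarrow> 0 < Im (z u)) \<Longrightarrow> multiaff V c z \<noteq> 0"
  shows "strongly_stable V c"
proof -
  have open_case: "multiaff V c (\<lambda>u. Im (z u)) \<le> norm (multiaff V c z)"
    if pos: "\<And>u. u \<in> V \<Longrightarrow> 0 < Im (z u)" for z :: "'a \<Rightarrow> complex"
  proof -
    define a where "a u = Im (z u)" for u
    define b where "b u = Re (z u)" for u
    let ?P = "multiaff_line V c (\<lambda>u. of_real (a u)) b"
    have z: "multiaff V c z = multiaff V c (\<lambda>u. of_real (b u) + \<i> * of_real (a u))"
      by (intro multiaff_cong) (simp add: a_def b_def complex_eq_iff)
    \<comment> \<open>Homogeneity allows dividing by \<open>s\<close>, and \<open>a u / s\<close>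
      lies in the upper half plane if \<open>s\<close> lies in the lower one.\<close>
    have lower: "poly ?P s \<noteq> 0" if s: "Im s < 0" for s
    proof
      assume "poly ?P s = 0"
      then have "multiaff V c (\<lambda>u. of_real (a u) + s * of_real (b u)) = 0" by (simp add: poly_multiaff_line)
      moreover have "multiaff V c (\<lambda>u. of_real (a u) + s * of_real (b u))
          = s ^ k * multiaff V c (\<lambda>u. of_real (a u) / s + of_real (b u))"
      proof -
        have "s \<noteq> 0" using s by auto
        then show ?thesis unfolding multiaff_scale[OF hom, symmetric]
          by (intro multiaff_cong) (simp add: distrib_left)
      qed
      ultimately have "multiaff V c (\<lambda>u. of_real (a u) / s + of_real (b u)) = 0" using s by auto
      moreover have "0 < Im (of_real (a u) / s + of_real (b u))" if "u \<in> V" for u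
      proof -
        have "0 < (Re s)\<^sup>2 + (Im s)\<^sup>2" using s by (simp add: sum_power2_gt_zero_iff)
        moreover have "0 < a u * - Im s" using pos[OF that] s by (intro mult_pos_pos) (auto simp: a_def)
        ultimately show ?thesis by (simp add: Im_divide divide_neg_pos)
      qed
      ultimately show False using nz[of "\<lambda>u. of_real (a u) / s + of_real (b u)"] by blast
    qed
    \<comment> \<open>The coefficients are real, so roots in the upper half plane would be mirrored
      in the lower one.\<close>
    have "cnj (poly ?P s) = poly ?P (cnj s)" for s
      by (simp add: poly_multiaff_line multiaff_def)
    note cnj_P = this
    have upper: "poly ?P s \<noteq> 0" if "Im s > 0" for s
      using lower[of "cnj s"] that unfolding cnj_P[symmetric] by simp
    have "Im s = 0" if "poly ?P s = 0" for s
      using lower[of s] upper[of s] that by force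
    then have "norm (poly ?P 0) \<le> norm (poly ?P (- \<i>))"
      by (intro norm_poly_0_le_if_roots_real)
    moreover have "norm (poly ?P 0) = multiaff V c a"
    proof -
      have "0 \<le> multiaff V c a" using pos by (intro multiaff_nonneg[OF hom]) (simp add: a_def less_imp_le)
      then show ?thesis by (simp add: poly_multiaff_line multiaff_of_real)
    qed
    moreover have "norm (poly ?P (- \<i>)) = norm (multiaff V c z)"
      unfolding poly_multiaff_line z by (rule norm_multiaff_rotate[OF hom])
    ultimately show ?thesis by (simp add: a_def[abs_def])
  qed
  show ?thesis
    unfolding strongly_stable_def
  proof (intro allI impI)
    fix z :: "'a \<Rightarrow> complex" assume z: "\<forall>u\<in>V. 0 \<le> Im (z u)"
    \<comment> \<open>Shifting all variables by \<open>\<i> t\<close> leads into the open half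
      plane; the inequality passes to the limit, which mere nonvanishing would not.\<close>
    have *: "multiaff V c (\<lambda>u. Im (z u) + of_real t * 1) \<le> norm (multiaff V c (\<lambda>u. z u + of_real t * \<i>))"
      if "t > 0" for t :: real
      using open_case[of "\<lambda>u. z u + of_real t * \<i>"] z that by (simp add: add_nonneg_pos)
    note tendsto_multiaff_line[of V c "\<lambda>u. Im (z u)" "\<lambda>_. 1"]
    moreover note tendsto_norm[OF tendsto_multiaff_line[of V c z "\<lambda>_. \<i>"]]
    moreover have "eventually (\<lambda>t. multiaff V c (\<lambda>u. Im (z u) + of_real t * 1)
        \<le> norm (multiaff V c (\<lambda>u. z u + of_real t * \<i>))) (at_right 0)"
      using * by (simp add: eventually_at_right_less eventually_at_filter)
    ultimately show "multiaff V c (\<lambda>u. Im (z u)) \<le> norm (multiaff V c z)"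
      by (intro tendsto_le[OF trivial_limit_at_right_real])
  qed
qed

lemma strongly_stableD:
  assumes "strongly_stable V c" "\<And>u. u \<in> V \<Longrightarrow> 0 \<le> Im (z u)"
  shows "multiaff V c (\<lambda>u. Im (z u)) \<le> norm (multiaff V c z)"
  using assms unfolding strongly_stable_def by blast

text \<open>On \<open>z + s d\<close> with \<open>Im s \<ge> 0\<close> strong stability bounds the
  norm below by a positive number, so the restriction has its roots in the open lower half plane and
  its derivative at 0, the value of the directional derivative, does not vanish.\<close>

lemma strongly_stable_dir_deriv:
  assumes fin: "finite V" and hom: "nonneg_homog V (Suc k) c" and st: "strongly_stable V c"
    and d: "\<And>u. u \<in> V \<Longrightarrow> 0 \<le> d u" and U: "U \<subseteq> V" "dir_deriv V d c U \<noteq> 0"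
  shows "strongly_stable V (dir_deriv V d c)"
proof (rule strongly_stableI[OF fin nonneg_homog_dir_deriv[OF fin hom d]])
  fix z :: "'a \<Rightarrow> complex" assume z: "\<And>u. u \<in> V \<Longrightarrow> 0 < Im (z u)"
  define a where "a u = Im (z u)" for u
  let ?P = "multiaff_line V c z d"
  obtain u where "u \<in> V - U" "c (insert u U) \<noteq> 0"
    using U(2) unfolding dir_deriv_def by (metis (no_types, lifting) mult_eq_0_iff sum.neutral)
  then have pos: "0 < multiaff V c a'" if "\<And>u. u \<in> V \<Longrightarrow> 0 < a' u" for a' :: "'a \<Rightarrow> real"
    using multiaff_pos[OF fin hom, of a' "insert u U"] U(1) that by (auto simp: less_imp_le)
  have dpos: "0 < multiaff V (dir_deriv V d c) a"
    using U(1) z by (intro multiaff_pos[OF fin nonneg_homog_dir_deriv[OF fin hom d] _ _ U]) (auto simp: a_def less_imp_le)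
  have low: "multiaff V c (\<lambda>u. a u + Im s * d u) \<le> norm (poly ?P s)" if "0 \<le> Im s" for s
    using strongly_stableD[OF st, of "\<lambda>u. z u + s * of_real (d u)"] z d that
    by (simp add: poly_multiaff_line a_def less_imp_le)
  have roots: "Im s < 0" if "poly ?P s = 0" for s
  proof (rule ccontr)
    assume "\<not> Im s < 0"
    moreover have "0 < multiaff V c (\<lambda>u. a u + Im s * d u)"
      using calculation z d by (intro pos) (auto simp: a_def add_pos_nonneg)
    ultimately show False using low[of s] that by auto
  qed
  \<comment> \<open>A constant \<open>q\<close> would have to dominate \<open>t\<close> times the
    positive directional derivative at \<open>a\<close> for all \<open>t \<ge> 0\<close>;
    \<open>?t\<close> makes this product equal to \<open>norm q + 1\<close>.\<close>
  have "degree ?P > 0"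
  proof (rule ccontr)
    assume "\<not> degree ?P > 0"
    then obtain q where q: "?P = [:q:]" by (metis degree_eq_zeroE neq0_conv)
    let ?t = "(norm q + 1) / multiaff V (dir_deriv V d c) a"
    have "norm q + 1 = ?t * multiaff V (dir_deriv V d c) a" using dpos by simp
    also have "\<dots> \<le> multiaff V c (\<lambda>u. a u + ?t * d u)"
      using multiaff_add_ge_linear[OF fin hom, of a d ?t] multiaff_nonneg[OF hom, of a] z d dpos
      by (simp add: a_def less_imp_le)
    also have "\<dots> \<le> norm (poly ?P (of_real ?t * \<i>))"
      using low[of "of_real ?t * \<i>"] dpos by simp
    finally show False by (simp add: q)
  qed
  from pderiv_0_neq_0_if_roots_lower_half_plane[OF this roots]
  show "multiaff V (dir_deriv V d c) z \<noteq> 0" by (simp add: pderiv_multiaff_line[OF fin])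
qed (use d in auto)

text \<open>Stability makes the restriction to a line with nonnegative base point and direction
  real-rooted with negative roots, so the exponential bound for such polynomials applies. No
  concavity in \<open>y\<close> has to be used.\<close>

lemma multiaff_line_le_exp:
  fixes l a :: "'a \<Rightarrow> real"
  assumes fin: "finite V" and hom: "nonneg_homog V k c" and st: "strongly_stable V c"
    and l: "\<And>u. u \<in> V \<Longrightarrow> 0 \<le> l u" and a: "\<And>u. u \<in> V \<Longrightarrow> 0 \<le> a u"
    and pos: "0 < multiaff V c l" and y: "0 \<le> y"
  shows "multiaff V c (\<lambda>u. l u + y * a u)
    \<le> multiaff V c l * exp (y * multiaff V (dir_deriv V a c) l / multiaff V c l)"
proof -
  let ?P = "multiaff_line V c (\<lambda>u. of_real (l u)) a"
  have "Im s = 0 \<and> Re s < 0" if root: "poly ?P s = 0" for s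
  proof (rule ccontr)
    assume neg: "\<not> (Im s = 0 \<and> Re s < 0)"
    \<comment> \<open>A multiplier with \<open>Im w = 1\<close> and
      \<open>Im (w * s) = \<bar>Re s\<bar> + Re s\<close> if \<open>Im s \<noteq> 0\<close>. If
      \<open>Im s = 0\<close>, then division by zero gives \<open>w = \<i>\<close>, and
      \<open>Im (w * s) = Re s\<close> is nonnegative by \<open>neg\<close>. Scaling by
      \<open>w\<close> thus lifts all imaginary parts to at least \<open>l u\<close>.\<close>
    define w where "w = Complex (\<bar>Re s\<bar> / Im s) 1"
    have ws: "0 \<le> Im (w * s)" using neg by (auto simp: w_def)
    have im: "Im (w * (of_real (l u) + s * of_real (a u))) = l u + Im (w * s) * a u" for u
    proof -
      have "w * (of_real (l u) + s * of_real (a u)) = w * of_real (l u) + (w * s) * of_real (a u)"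
        by (simp add: distrib_left)
      then show ?thesis by (simp only: plus_complex.simps Im_complex_of_real times_complex.simps) (simp add: w_def)
    qed
    have "multiaff V c l \<le> multiaff V c (\<lambda>u. Im (w * (of_real (l u) + s * of_real (a u))))"
    proof (rule multiaff_mono[OF hom l])
      fix u assume "u \<in> V"
      then have "0 \<le> Im (w * s) * a u" using ws a by simp
      then show "l u \<le> Im (w * (of_real (l u) + s * of_real (a u)))"
        by (simp only: im)
    qed
    also have "\<dots> \<le> norm (multiaff V c (\<lambda>u. w * (of_real (l u) + s * of_real (a u))))"
    proof (rule strongly_stableD[OF st])
      fix u assume "u \<in> V"
      then have "0 \<le> Im (w * s) * a u" "0 \<le> l u" using ws a l by auto
      then show "0 \<le> Im (w * (of_real (l u) + s * of_real (a u)))"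
        by (simp only: im)
    qed
    also have "\<dots> = 0" unfolding multiaff_scale[OF hom] using root by (simp add: poly_multiaff_line)
    finally show False using pos by simp
  qed
  moreover have "poly ?P 0 = of_real (multiaff V c l)"
    by (simp add: poly_multiaff_line multiaff_of_real)
  moreover have "poly (pderiv ?P) 0 = of_real (multiaff V (dir_deriv V a c) l)"
    by (simp add: pderiv_multiaff_line[OF fin] multiaff_of_real)
  ultimately have "Re (poly ?P (of_real y))
      \<le> multiaff V c l * exp (y * multiaff V (dir_deriv V a c) l / multiaff V c l)"
    using pos y by (intro poly_le_exp_if_roots_negative) auto
  moreover have "poly ?P (of_real y) = of_real (multiaff V c (\<lambda>u. l u + y * a u))"
    by (simp add: poly_multiaff_line multiaff_of_real[symmetric])
  ultimately show ?thesis by simp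
qed

lemma multiaff_add_single:
  assumes fin: "finite V" and e: "\<And>u. u \<noteq> v \<Longrightarrow> e u = 0"
  shows "multiaff V c (\<lambda>u. z u + x * of_real (e u)) = multiaff V c z + x * multiaff V (dir_deriv V e c) z"
proof -
  have "(\<Prod>u\<in>U. z u + x * of_real (e u))
      = (\<Prod>u\<in>U. z u) + x * (\<Sum>u\<in>U. of_real (e u) * (\<Prod>w\<in>U - {u}. z w))" if "finite U" for U
  proof (cases "v \<in> U")
    case True
    have "(\<Prod>u\<in>U - {v}. z u + x * of_real (e u)) = (\<Prod>u\<in>U - {v}. z u)"
      by (intro prod.cong) (auto simp: e)
    moreover have "(\<Sum>u\<in>U - {v}. of_real (e u) * (\<Prod>w\<in>U - {u}. z w)) = 0"
      by (intro sum.neutral) (auto simp: e)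
    ultimately show ?thesis
      using that True by (simp add: prod.remove[OF that True] sum.remove[OF that True] algebra_simps)
  next
    case False
    then have "e u = 0" if "u \<in> U" for u using that e by metis
    then show ?thesis by simp
  qed
  then show ?thesis
    unfolding multiaff_dir_deriv[OF fin] unfolding multiaff_def sum_distrib_left sum.distrib[symmetric]
    using fin by (intro sum.cong refl) (auto simp: finite_subset distrib_left sum_distrib_left mult_ac)
qed

text \<open>The Rayleigh (negative correlation) inequality of stable polynomials. As
  \<open>f\<close> is affine in the variable \<open>v\<close>, its root in that variable, minus
  \<open>f\<close> over its derivative along \<open>e\<close>, cannot enter the upper half plane.
  The inequality is the first order term of this condition at the real point \<open>l\<close>, along
  \<open>l + \<i> t a\<close>.\<close>

lemma multiaff_rayleigh:
  fixes l a e :: "'a \<Rightarrow> real"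
  assumes fin: "finite V" and hom: "nonneg_homog V k c" and st: "strongly_stable V c"
    and l: "\<And>u. u \<in> V \<Longrightarrow> 0 \<le> l u" and a: "\<And>u. u \<in> V \<Longrightarrow> 0 \<le> a u"
    and e: "\<And>u. u \<noteq> v \<Longrightarrow> e u = 0" "0 \<le> e v"
    and pos: "0 < multiaff V c l"
  shows "multiaff V (dir_deriv V a (dir_deriv V e c)) l * multiaff V c l
    \<le> multiaff V (dir_deriv V e c) l * multiaff V (dir_deriv V a c) l"
proof -
  let ?f = "dir_deriv V e c"
  define L where "L s = (\<lambda>u. of_real (l u) + s * of_real (a u))" for s :: complex
  have nonneg: "0 \<le> Im (multiaff V c (L (\<i> * of_real t)) * cnj (multiaff V ?f (L (\<i> * of_real t))))"
    if t: "t > 0" for t :: real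
  proof -
    \<comment> \<open>The term \<open>\<i> \<epsilon> l\<close> keeps the imaginary parts above
      \<open>\<epsilon> l\<close>, where the polynomial is positive; \<open>l + \<i> t a\<close>
      alone may lie on the boundary in a degenerate way.\<close>
    define Z where "Z \<epsilon> = (\<lambda>u. L (\<i> * of_real t) u + of_real \<epsilon> * (\<i> * of_real (l u)))" for \<epsilon> :: real
    have "0 \<le> Im (multiaff V c (Z \<epsilon>) * cnj (multiaff V ?f (Z \<epsilon>)))" if \<epsilon>: "\<epsilon> > 0" for \<epsilon>
    proof (rule ccontr)
      define F G x where "F = multiaff V ?f (Z \<epsilon>)" and "G = multiaff V c (Z \<epsilon>)" and "x = - G / F"
      assume "\<not> ?thesis"
      then have neg: "Im (G * cnj F) < 0" by (simp add: F_def G_def)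
      then have F: "F \<noteq> 0" by auto
      have "x = - (G * cnj F) / of_real ((norm F)\<^sup>2)"
        by (simp add: x_def complex_div_cnj[of G F])
      then have x: "0 < Im x" using neg F by (simp add: Im_divide_of_real divide_neg_pos)
      have "multiaff V c (\<lambda>u. Z \<epsilon> u + x * of_real (e u)) = G + x * F"
        unfolding F_def G_def by (rule multiaff_add_single[OF fin e(1)])
      then have zero: "multiaff V c (\<lambda>u. Z \<epsilon> u + x * of_real (e u)) = 0" using F by (simp add: x_def)
      have im: "Im (Z \<epsilon> u + x * of_real (e u)) = \<epsilon> * l u + (t * a u + Im x * e u)" for u
        by (simp add: Z_def L_def)
      have ge: "0 \<le> t * a u + Im x * e u" "0 \<le> \<epsilon> * l u" if "u \<in> V" for u
        using t a[OF that] l[OF that] x e \<epsilon> by (cases "u = v", auto)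
      have "\<epsilon> ^ k * multiaff V c l = multiaff V c (\<lambda>u. \<epsilon> * l u)" by (simp add: multiaff_scale[OF hom])
      also have "\<dots> \<le> multiaff V c (\<lambda>u. Im (Z \<epsilon> u + x * of_real (e u)))"
        unfolding im using ge by (intro multiaff_mono[OF hom]) auto
      also have "\<dots> \<le> norm (multiaff V c (\<lambda>u. Z \<epsilon> u + x * of_real (e u)))"
      proof (rule strongly_stableD[OF st])
        fix u assume "u \<in> V"
        then show "0 \<le> Im (Z \<epsilon> u + x * of_real (e u))" unfolding im using ge by fastforce
      qed
      finally show False using zero pos \<epsilon> by (simp add: mult_le_0_iff zero_less_power not_less[symmetric])
    qed
    then have "eventually (\<lambda>\<epsilon>. 0 \<le> Im (multiaff V c (Z \<epsilon>) * cnj (multiaff V ?f (Z \<epsilon>)))) (at_right 0)"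
      by (simp add: eventually_at_filter)
    moreover have "((\<lambda>\<epsilon>. Im (multiaff V c (Z \<epsilon>) * cnj (multiaff V ?f (Z \<epsilon>))))
        \<longlongrightarrow> Im (multiaff V c (L (\<i> * of_real t)) * cnj (multiaff V ?f (L (\<i> * of_real t))))) (at_right 0)"
      unfolding Z_def by (intro tendsto_intros tendsto_multiaff_line)
    ultimately show ?thesis by (intro tendsto_lowerbound[OF _ _ trivial_limit_at_right_real])
  qed
  define PF PG where "PF = multiaff_line V ?f (\<lambda>u. of_real (l u)) a" and "PG = multiaff_line V c (\<lambda>u. of_real (l u)) a"
  \<comment> \<open>On the imaginary axis \<open>PF (- s)\<close> is the conjugate of
    \<open>PF s\<close>. Hence \<open>H\<close> is a polynomial that agrees there with the product
    of \<open>PG\<close> and the conjugate of \<open>PF\<close>, and its linear coefficient is the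
    difference wanted.\<close>
  define H where "H = PG * (pcompose PF [:0, -1:])"
  have cnj_PF: "cnj (poly PF s) = poly PF (cnj s)" for s
    by (simp add: PF_def poly_multiaff_line multiaff_def)
  have H: "poly H (\<i> * of_real t) = multiaff V c (L (\<i> * of_real t)) * cnj (multiaff V ?f (L (\<i> * of_real t)))" for t
  proof -
    have "poly H (\<i> * of_real t) = poly PG (\<i> * of_real t) * cnj (poly PF (\<i> * of_real t))"
      by (simp add: H_def poly_pcompose cnj_PF)
    then show ?thesis by (simp add: PF_def PG_def poly_multiaff_line L_def)
  qed
  obtain h0 h1 R where HR: "H = pCons h0 (pCons h1 R)" by (metis pCons_cases)
  have h0: "h0 = poly H 0" by (simp add: HR)
  have "Im h0 = 0"
    unfolding h0 using H[of 0] by (simp add: L_def multiaff_of_real)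
  have h1: "h1 = poly (pderiv H) 0" by (simp add: HR pderiv_pCons)
  have "h1 = poly (pderiv PG) 0 * poly PF 0 - poly PG 0 * poly (pderiv PF) 0"
    unfolding h1 H_def by (simp add: pderiv_mult pderiv_pcompose poly_pcompose pderiv_pCons)
  then have "h1 = of_real (multiaff V (dir_deriv V a c) l * multiaff V ?f l
      - multiaff V c l * multiaff V (dir_deriv V a ?f) l)"
    by (simp add: PF_def PG_def pderiv_multiaff_line[OF fin] poly_multiaff_line multiaff_of_real)
  moreover have "0 \<le> Re h1"
  proof (rule tendsto_lowerbound[OF _ _ trivial_limit_at_right_real])
    have "((\<lambda>t. Re (h1 + \<i> * of_real t * poly R (\<i> * of_real t)))
        \<longlongrightarrow> Re (h1 + \<i> * of_real 0 * poly R (\<i> * of_real 0))) (at_right 0)"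
      by (intro tendsto_intros)
    then show "((\<lambda>t. Re (h1 + \<i> * of_real t * poly R (\<i> * of_real t))) \<longlongrightarrow> Re h1) (at_right 0)" by simp
    have "0 \<le> Re (h1 + \<i> * of_real t * poly R (\<i> * of_real t))" if "t > 0" for t :: real
    proof -
      have "0 \<le> Im (poly H (\<i> * of_real t))" unfolding H by (rule nonneg[OF that])
      also have "\<dots> = t * Re (h1 + \<i> * of_real t * poly R (\<i> * of_real t))"
        using \<open>Im h0 = 0\<close> by (simp add: HR)
      finally show ?thesis using that by (simp add: zero_le_mult_iff)
    qed
    then show "eventually (\<lambda>t. 0 \<le> Re (h1 + \<i> * of_real t * poly R (\<i> * of_real t))) (at_right 0)"
      by (simp add: eventually_at_filter)
  qed
  ultimately show ?thesis by (simp add: mult.commute)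
qed

text \<open>One step of Gurvits' induction, reduced to numbers: \<open>g0 + x * f0\<close> is the
  value of the polynomial, \<open>g1 + x * f1\<close> its derivative along the off-diagonal part of
  the row, and \<open>f0 + g1\<close> the derivative along the whole row. Optimising
  \<open>y\<close>, then Young's inequality, then optimising \<open>x\<close> gives the claim; the
  Rayleigh inequality absorbs the mixed term \<open>f1\<close>.\<close>

lemma capacity_step:
  fixes f0 f1 g0 g1 \<alpha> K :: real
  assumes f0: "0 < f0" and g0: "0 \<le> g0" and f1: "0 \<le> f1" and g1: "0 \<le> g1"
    and rayleigh: "f1 * g0 \<le> f0 * g1" and \<alpha>: "0 < \<alpha>" "\<alpha> \<le> 1" and K: "0 < K"
    and bound: "\<And>x y. \<lbrakk>0 < x; 0 < y\<rbrakk> \<Longrightarrow>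
      K * (x powr (1 - \<alpha>) * y powr \<alpha>) \<le> (g0 + x * f0) * exp (y * (g1 + x * f1) / (g0 + x * f0))"
  shows "K * (\<alpha> / exp 1) powr \<alpha> \<le> f0 + g1"
proof -
  define A B where "A x = f0 + g0 / x" and "B x = g1 + x * f1" for x
  have A: "0 < A x" "g0 + x * f0 = x * A x" if "0 < x" for x
    using that f0 g0 by (simp_all add: A_def add_pos_nonneg distrib_left)
  \<comment> \<open>If \<open>B x\<close> were 0, the right side of \<open>bound\<close> would not
    depend on \<open>y\<close> while the left side is unbounded in \<open>y\<close>.\<close>
  have B_pos: "0 < B x" if x: "0 < x" for x
  proof (rule ccontr)
    assume "\<not> 0 < B x"
    then have "B x = 0" using f1 g1 x by (simp add: B_def add_nonneg_nonneg order_antisym)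
    then have *: "K * (x powr (1 - \<alpha>) * y powr \<alpha>) \<le> x * A x" if "0 < y" for y
      using bound[OF x that] A(2)[OF x] by (simp add: B_def)
    define M where "M = x * A x / (K * x powr (1 - \<alpha>)) + 1"
    have M: "0 < M" using A(1)[OF x] x K by (simp add: M_def add_nonneg_pos)
    have "K * (x powr (1 - \<alpha>) * M) \<le> x * A x"
      using *[of "M powr (1 / \<alpha>)"] M \<alpha> by (simp add: powr_powr)
    moreover have "K * (x powr (1 - \<alpha>) * M) = x * A x + K * x powr (1 - \<alpha>)"
      using K x by (simp add: M_def field_simps)
    ultimately show False using K x by (simp add: not_less[symmetric])
  qed
  have main: "K * (\<alpha> / exp 1) powr \<alpha> \<le> A x powr (1 - \<alpha>) * B x powr \<alpha>" if x: "0 < x" for x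
  proof -
    \<comment> \<open>The minimiser of \<open>exp (y * B x / (x * A x)) / y powr \<alpha>\<close>;
      the exponent becomes \<open>\<alpha>\<close>.\<close>
    define y where "y = \<alpha> * (x * A x) / B x"
    have y: "0 < y" "y * B x / (x * A x) = \<alpha>"
      using x A(1)[OF x] B_pos[OF x] \<alpha> by (auto simp: y_def)
    have "K * (x powr (1 - \<alpha>) * y powr \<alpha>) \<le> x * A x * exp \<alpha>"
      using bound[OF x y(1)] y(2) A(2)[OF x] by (simp add: B_def)
    moreover have "x powr (1 - \<alpha>) * y powr \<alpha> = x * A x powr \<alpha> * \<alpha> powr \<alpha> / B x powr \<alpha>"
      using x A(1)[OF x] B_pos[OF x] \<alpha>
      by (simp add: y_def powr_divide powr_mult powr_diff)
    ultimately have "x * (K * (A x powr \<alpha> * \<alpha> powr \<alpha> / B x powr \<alpha>)) \<le> x * (A x * exp \<alpha>)"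
      by (simp add: mult_ac)
    then have "K * (A x powr \<alpha> * \<alpha> powr \<alpha> / B x powr \<alpha>) \<le> A x * exp \<alpha>"
      using x by (simp only: mult_le_cancel_left_pos)
    then have "K * (\<alpha> powr \<alpha> / exp \<alpha>) \<le> A x / A x powr \<alpha> * B x powr \<alpha>"
      using x A(1)[OF x] B_pos[OF x] by (simp add: field_simps)
    moreover have "(\<alpha> / exp 1) powr \<alpha> = \<alpha> powr \<alpha> / exp \<alpha>"
      using \<alpha> by (simp add: powr_divide exp_powr_real)
    moreover have "A x powr (1 - \<alpha>) = A x / A x powr \<alpha>"
      using A(1)[OF x] by (simp add: powr_diff)
    ultimately show ?thesis by simp
  qed
  have young: "A x powr (1 - \<alpha>) * B x powr \<alpha> \<le> (1 - \<alpha>) * A x + \<alpha> * B x" if "0 < x" for x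
    using that A(1) B_pos \<alpha> by (intro Youngs_inequality_0) (auto simp: less_imp_le)
  show ?thesis
  proof (cases "g0 = 0 \<or> \<alpha> = 1")
    \<comment> \<open>The optimal \<open>x\<close> of the other case degenerates to 0, so small
      positive \<open>x\<close> are used instead.\<close>
    case True
    show ?thesis
    proof (rule field_le_epsilon)
      fix \<epsilon> :: real assume \<epsilon>: "0 < \<epsilon>"
      define x where "x = \<epsilon> / (f1 + 1)"
      have x: "0 < x" "x * f1 \<le> \<epsilon>" using \<epsilon> f1 by (auto simp: x_def field_simps)
      have "(1 - \<alpha>) * A x + \<alpha> * B x \<le> f0 + B x"
      proof -
        have "(1 - \<alpha>) * A x = (1 - \<alpha>) * f0" using True by (auto simp: A_def)
        also have "\<dots> \<le> f0" using \<alpha> f0 by (simp add: mult_left_le_one_le)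
        finally show ?thesis using \<alpha> B_pos[OF x(1)] by (smt (verit) mult_left_le_one_le)
      qed
      then show "K * (\<alpha> / exp 1) powr \<alpha> \<le> f0 + g1 + \<epsilon>"
        using main[OF x(1)] young[OF x(1)] x(2) by (simp add: B_def)
    qed
  next
    case False
    \<comment> \<open>Chosen so that \<open>(1 - \<alpha>) * A x = f0\<close>. Then
      \<open>\<alpha> * x * f1\<close> is \<open>(1 - \<alpha>) * f1 * g0 / f0\<close>, which is at
      most \<open>(1 - \<alpha>) * g1\<close>.\<close>
    define x where "x = (1 - \<alpha>) * g0 / (\<alpha> * f0)"
    have x: "0 < x" using False \<alpha> f0 g0 by (auto simp: x_def)
    have "(1 - \<alpha>) * A x = f0" using False \<alpha> f0 by (simp add: A_def x_def field_simps)
    moreover have "\<alpha> * B x \<le> g1"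
    proof -
      have "\<alpha> * (x * f1) = (1 - \<alpha>) * (f1 * g0) / f0" using \<alpha> f0 by (simp add: x_def field_simps)
      also have "\<dots> \<le> (1 - \<alpha>) * (f0 * g1) / f0"
        using rayleigh \<alpha> f0 by (intro divide_right_mono mult_left_mono) auto
      also have "\<dots> = (1 - \<alpha>) * g1" using f0 by simp
      finally show ?thesis by (simp add: B_def algebra_simps)
    qed
    ultimately show ?thesis using main[OF x] young[OF x] by simp
  qed
qed

lemma dir_deriv_add: "dir_deriv V (\<lambda>u. d u + d' u) c U = dir_deriv V d c U + dir_deriv V d' c U"
  by (simp add: dir_deriv_def distrib_right sum.distrib)

lemma multiaff_add_coeff: "multiaff V (\<lambda>U. c U + c' U) z = multiaff V c z + multiaff V c' z"
  by (simp add: multiaff_def distrib_right sum.distrib)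

lemma dir_deriv_commute:
  assumes "finite V"
  shows "dir_deriv V d (dir_deriv V d' c) = dir_deriv V d' (dir_deriv V d c)"
proof
  fix U
  have fin: "finite (V - U)" using assms by simp
  have eq: "dir_deriv V d (dir_deriv V d' c) U
      = (\<Sum>u\<in>V - U. \<Sum>w\<in>V - U. if u = w then 0 else d u * d' w * c (insert w (insert u U)))" for d d'
  proof -
    have "dir_deriv V d' c (insert u U)
        = (\<Sum>w\<in>V - U. if u = w then 0 else d' w * c (insert w (insert u U)))" if "u \<in> V - U" for u
      unfolding dir_deriv_def using that fin
      by (intro sum.mono_neutral_cong_left) auto
    then show ?thesis
      unfolding dir_deriv_def[of V d]
      by (intro sum.cong refl) (auto simp: sum_distrib_left mult_ac intro!: sum.cong)
  qed
  show "dir_deriv V d (dir_deriv V d' c) U = dir_deriv V d' (dir_deriv V d c) U"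
    unfolding eq by (subst sum.swap) (auto intro!: sum.cong simp: insert_commute mult_ac)
qed

section \<open>Permanents\<close>

definition permanent :: "'a set \<Rightarrow> ('a \<Rightarrow> 'a \<Rightarrow> real) \<Rightarrow> real" where
  "permanent V M = (\<Sum>p | p permutes V. \<Prod>v\<in>V. M v (p v))"

text \<open>Starts from the monomial of all variables in \<open>V\<close> and differentiates it
  along the rows of \<open>M\<close> in the list, the head last. After all rows only a constant is
  left, the permanent.\<close>

fun mixed_derivative :: "'a set \<Rightarrow> ('a \<Rightarrow> 'a \<Rightarrow> real) \<Rightarrow> 'a list \<Rightarrow> 'a set \<Rightarrow> real" where
  "mixed_derivative V M [] U = (if U = V then 1 else 0)"
| "mixed_derivative V M (v # vs) U = dir_deriv V (M v) (mixed_derivative V M vs) U"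

lemma mixed_derivative_Cons: "mixed_derivative V M (v # vs) = dir_deriv V (M v) (mixed_derivative V M vs)"
  by (rule ext) simp

text \<open>Each row \<open>v\<close> removes one variable \<open>f v\<close>, so the coefficient at
  \<open>U\<close> collects the ways of removing exactly \<open>V - U\<close>. Fixing
  \<open>f\<close> outside \<open>set vs\<close> makes it unique, and a permutation once all rows
  are used.\<close>

lemma mixed_derivative_eq_sum_bij:
  assumes "finite V" "distinct vs" "U \<subseteq> V"
  shows "mixed_derivative V M vs U
    = (\<Sum>f | bij_betw f (set vs) (V - U) \<and> (\<forall>x. x \<notin> set vs \<longrightarrow> f x = x). \<Prod>v\<in>set vs. M v (f v))"
  using assms(2,3)
proof (induction vs arbitrary: U)
  case Nil
  have "{f. bij_betw f {} (V - U) \<and> (\<forall>x. f x = x)} = (if U = V then {\<lambda>x. x} else {})"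
    using Nil by (auto simp: bij_betw_def)
  then show ?case by simp
next
  case (Cons v vs)
  define F where "F W R = {f. bij_betw f W R \<and> (\<forall>x. x \<notin> W \<longrightarrow> f x = x)}" for W R :: "'a set"
  have fin: "finite (F (set vs) R)" if "R \<subseteq> V" for R
  proof (rule finite_subset)
    have "f ` set vs \<subseteq> V \<and> (\<forall>x. x \<notin> set vs \<longrightarrow> f x = x)" if "f \<in> F (set vs) R" for f
      using that \<open>R \<subseteq> V\<close> by (auto simp: F_def bij_betw_def)
    then show "F (set vs) R \<subseteq> (\<lambda>g x. if x \<in> set vs then g x else x) ` (set vs \<rightarrow>\<^sub>E V)"
      by (intro subsetI image_eqI[where x = "restrict _ (set vs)"]) (auto simp: fun_eq_iff)
    show "finite ((\<lambda>g x. if x \<in> set vs then g x else x) ` (set vs \<rightarrow>\<^sub>E V))"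
      using assms(1) by (intro finite_imageI finite_PiE) auto
  qed
  have v: "v \<notin> set vs" "distinct vs" using Cons by auto
  have "mixed_derivative V M (v # vs) U
      = (\<Sum>u\<in>V - U. M v u * (\<Sum>f\<in>F (set vs) (V - insert u U). \<Prod>w\<in>set vs. M w (f w)))"
    unfolding mixed_derivative.simps dir_deriv_def F_def
    using Cons.prems by (intro sum.cong refl arg_cong2[where f = "(*)"] Cons.IH) auto
  also have "\<dots> = (\<Sum>(u, f)\<in>(SIGMA u:V - U. F (set vs) (V - insert u U)).
      M v u * (\<Prod>w\<in>set vs. M w (f w)))"
    unfolding sum_distrib_left using assms(1) Cons.prems(2) by (intro sum.Sigma ballI fin) auto
  also have "\<dots> = (\<Sum>f\<in>F (set (v # vs)) (V - U). \<Prod>w\<in>set (v # vs). M w (f w))"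
  proof (rule sum.reindex_bij_witness[of _ "\<lambda>f. (f v, f(v := v))" "\<lambda>(u, f). f(v := u)"])
    fix uf assume uf: "uf \<in> (SIGMA u:V - U. F (set vs) (V - insert u U))"
    then obtain u f where [simp]: "uf = (u, f)" and u: "u \<in> V - U" and f: "f \<in> F (set vs) (V - insert u U)"
      by auto
    have fv: "f v = v" using f v by (auto simp: F_def)
    show "(case uf of (u, f) \<Rightarrow> f(v := u)) \<in> F (set (v # vs)) (V - U)"
    proof -
      have "bij_betw (f(v := u)) (set vs) (V - insert u U)"
      proof (subst bij_betw_cong[of _ _ f])
        show "(f(v := u)) w = f w" if "w \<in> set vs" for w using that v by auto
        show "bij_betw f (set vs) (V - insert u U)" using f by (simp add: F_def)
      qed
      then have "bij_betw (f(v := u)) (insert v (set vs)) (insert u (V - insert u U))"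
        using v notIn_Un_bij_betw[of v "set vs" "f(v := u)" "V - insert u U"] by simp
      moreover have "insert u (V - insert u U) = V - U" using u by auto
      ultimately show ?thesis using f by (auto simp: F_def)
    qed
    show "((case uf of (u, f) \<Rightarrow> f(v := u)) v, (case uf of (u, f) \<Rightarrow> f(v := u))(v := v)) = uf"
      using fv by auto
    have "(\<Prod>w\<in>set vs. M w ((f(v := u)) w)) = (\<Prod>w\<in>set vs. M w (f w))"
      using v by (intro prod.cong) auto
    then show "(\<Prod>w\<in>set (v # vs). M w ((case uf of (u, f) \<Rightarrow> f(v := u)) w))
        = (case uf of (u, f) \<Rightarrow> M v u * (\<Prod>w\<in>set vs. M w (f w)))"
      using v by simp
  next
    fix f assume f: "f \<in> F (set (v # vs)) (V - U)"
    show "(case (f v, f(v := v)) of (u, f) \<Rightarrow> f(v := u)) = f" by simp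
    have "bij_betw f (insert v (set vs)) (V - U)" using f by (simp add: F_def)
    then have *: "f v \<in> V - U" "bij_betw f (set vs) (V - U - {f v})"
      using v by (auto simp: bij_betw_def inj_on_def)
    have "bij_betw (f(v := v)) (set vs) (V - insert (f v) U)"
    proof (subst bij_betw_cong[of _ _ f])
      show "(f(v := v)) w = f w" if "w \<in> set vs" for w using that v by auto
      show "bij_betw f (set vs) (V - insert (f v) U)"
        by (subst Diff_insert) (rule *(2))
    qed
    then show "(f v, f(v := v)) \<in> (SIGMA u:V - U. F (set vs) (V - insert u U))"
      using f v *(1) by (auto simp: F_def)
  qed
  finally show ?case by (simp add: F_def)
qed

lemma mixed_derivative_eq_permanent:
  assumes "finite V" "distinct vs" "set vs = V"
  shows "mixed_derivative V M vs {} = permanent V M"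
proof -
  have "{f. bij_betw f V V \<and> (\<forall>x. x \<notin> V \<longrightarrow> f x = x)} = {p. p permutes V}"
    by (auto intro: bij_imp_permutes permutes_imp_bij permutes_not_in)
  then show ?thesis
    using mixed_derivative_eq_sum_bij[OF assms(1,2), of "{}" M] assms(3) by (simp add: permanent_def)
qed

section \<open>A lower bound for permanents\<close>

lemma multiaff_dir_deriv_nonneg:
  fixes z :: "'a \<Rightarrow> real"
  assumes "nonneg_homog V k c" "\<And>u. u \<in> V \<Longrightarrow> 0 \<le> d u" "\<And>u. u \<in> V \<Longrightarrow> 0 \<le> z u"
  shows "0 \<le> multiaff V (dir_deriv V d c) z"
  unfolding multiaff_def dir_deriv_def using assms
  by (intro sum_nonneg mult_nonneg_nonneg prod_nonneg) (auto simp: nonneg_homog_def intro!: sum_nonneg)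

lemma weighted_arith_geom_mean:
  fixes x w :: "'a \<Rightarrow> real"
  assumes "finite S" "\<And>i. i \<in> S \<Longrightarrow> 0 \<le> w i" "\<And>i. i \<in> S \<Longrightarrow> 0 < x i" "0 \<le> w0" "0 < x0"
    and "w0 + sum w S = 1"
  shows "x0 powr w0 * (\<Prod>i\<in>S. x i powr w i) \<le> w0 * x0 + (\<Sum>i\<in>S. w i * x i)"
proof -
  define L where "L = w0 * ln x0 + (\<Sum>i\<in>S. w i * ln (x i))"
  have G: "x0 powr w0 * (\<Prod>i\<in>S. x i powr w i) = exp L"
  proof -
    have "(\<Prod>i\<in>S. x i powr w i) = exp (\<Sum>i\<in>S. w i * ln (x i))"
      unfolding exp_sum[OF assms(1)] using assms(3) by (intro prod.cong) (fastforce simp: powr_def)+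
    then show ?thesis using assms by (simp add: L_def exp_add powr_def)
  qed
  \<comment> \<open>The tangent of the exponential function at \<open>L\<close>, the logarithm of
    the geometric mean. The weighted sum of the left sides is exactly \<open>exp L\<close>.\<close>
  have tangent: "t * (exp L * (1 + (ln y - L))) \<le> t * y" if "0 \<le> t" "0 < y" for t y
  proof -
    have "exp L * (1 + (ln y - L)) \<le> exp L * exp (ln y - L)"
      by (intro mult_left_mono exp_ge_add_one_self) simp
    also have "\<dots> = y" using that by (simp add: exp_add[symmetric])
    finally show ?thesis using that by (intro mult_left_mono)
  qed
  have "(\<Sum>i\<in>S. w i * (exp L * (1 + (ln (x i) - L))))
      = exp L * (sum w S * (1 - L) + (\<Sum>i\<in>S. w i * ln (x i)))"
    by (simp add: sum_distrib_left sum_distrib_right sum.distrib[symmetric] algebra_simps)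
  then have "w0 * (exp L * (1 + (ln x0 - L))) + (\<Sum>i\<in>S. w i * (exp L * (1 + (ln (x i) - L))))
      = exp L * ((w0 + sum w S) * (1 - L) + (w0 * ln x0 + (\<Sum>i\<in>S. w i * ln (x i))))"
    by (simp add: algebra_simps)
  also have "\<dots> = exp L * ((w0 + sum w S) * (1 - L) + L)" by (simp only: L_def)
  also have "\<dots> = exp L" using assms(6) by simp
  finally have "exp L \<le> w0 * x0 + (\<Sum>i\<in>S. w i * x i)"
    using tangent[of w0 x0] sum_mono[of S "\<lambda>i. w i * (exp L * (1 + (ln (x i) - L)))" "\<lambda>i. w i * x i"]
      tangent assms(2-5) by force
  then show ?thesis by (simp add: G)
qed

context
  fixes V :: "'a set" and a :: "'a \<Rightarrow> 'a \<Rightarrow> real" and d c :: "'a \<Rightarrow> real" and \<Delta> :: real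
  assumes fin: "finite V" and a: "\<And>u v. 0 \<le> a u v"
    and row: "\<And>v. v \<in> V \<Longrightarrow> (\<Sum>u\<in>V. a v u) = d v"
    and col: "\<And>u. u \<in> V \<Longrightarrow> (\<Sum>v\<in>V. a v u) = d u"
    and d: "\<And>v. v \<in> V \<Longrightarrow> 0 < d v" "\<And>v. v \<in> V \<Longrightarrow> d v \<le> \<Delta>"
    and c: "\<And>v. v \<in> V \<Longrightarrow> 0 < c v" "\<And>v. v \<in> V \<Longrightarrow> (1 - d v / \<Delta>) * (d v / exp 1) \<le> c v"
begin

text \<open>The capacity bound is maintained for the polynomial in two variables \<open>x v\<close>, \<open>y v\<close> for each
  vertex \<open>v\<close>, of which \<open>x v\<close> selects the diagonal entry. The exponents \<open>1 - d v / \<Delta>\<close> and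
  \<open>d v / \<Delta>\<close> come from the doubly stochastic matrix with off-diagonal part \<open>a / \<Delta>\<close>.\<close>

abbreviation (input) expo where "expo v \<equiv> d v / \<Delta>"

abbreviation (input) bordered where "bordered v u \<equiv> (if u = v then c v else 0) + a v u"

text \<open>The combination of the rows in \<open>W\<close> in which the diagonal part of row
  \<open>v\<close> has coefficient \<open>x v\<close> and its off-diagonal part has coefficient
  \<open>y v\<close>.\<close>

definition eval_point where
  "eval_point W x y u = (if u \<in> W then c u * x u else 0) + (\<Sum>v\<in>W. a v u * y v)"

text \<open>Eliminating \<open>v\<close> costs the factor \<open>(expo v / e) powr expo v\<close>,
  which turns this weight into \<open>d v / e\<close>.\<close>

abbreviation (input) weight where
  "weight v \<equiv> (d v / exp 1) powr (1 - expo v) * \<Delta> powr expo v"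

definition capacity_bound where
  "capacity_bound vs \<longleftrightarrow> (\<forall>x y. (\<forall>v\<in>V. 0 < x v \<and> 0 < y v) \<longrightarrow>
     (\<Prod>v\<in>set vs. d v / exp 1) * (\<Prod>v\<in>V - set vs. weight v * (x v powr (1 - expo v) * y v powr expo v))
       \<le> multiaff V (mixed_derivative V bordered vs) (eval_point (V - set vs) x y))"

text \<open>The polynomial is a product over columns \<open>u\<close>. Weighted AM-GM with weights
  \<open>1 - expo u\<close> and \<open>a v u / \<Delta>\<close>, which add up to 1 by the column
  sum, bounds each factor; the exponents of each \<open>y v\<close> are then collected by the row
  sum.\<close>

lemma capacity_bound_Nil: "capacity_bound []"
  unfolding capacity_bound_def
proof (intro allI impI)
  fix x y :: "'a \<Rightarrow> real" assume pos: "\<forall>v\<in>V. 0 < x v \<and> 0 < y v"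
  have \<Delta>: "0 < \<Delta>" if "v \<in> V" for v using d[OF that] by simp
  have "(\<Prod>v\<in>V. weight v * (x v powr (1 - expo v) * y v powr expo v))
      = (\<Prod>v\<in>V. (d v / exp 1 * x v) powr (1 - expo v)) * (\<Prod>v\<in>V. (\<Delta> * y v) powr expo v)"
    unfolding prod.distrib[symmetric]
    by (intro prod.cong refl) (simp only: powr_mult mult_ac)
  also have "(\<Prod>v\<in>V. (\<Delta> * y v) powr expo v) = (\<Prod>v\<in>V. \<Prod>u\<in>V. (\<Delta> * y v) powr (a v u / \<Delta>))"
  proof (intro prod.cong refl)
    fix v assume v: "v \<in> V"
    have "expo v = (\<Sum>u\<in>V. a v u / \<Delta>)" unfolding sum_divide_distrib[symmetric] row[OF v] ..
    moreover have "\<Delta> * y v \<noteq> 0" using \<Delta>[OF v] pos v by force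
    ultimately show "(\<Delta> * y v) powr expo v = (\<Prod>u\<in>V. (\<Delta> * y v) powr (a v u / \<Delta>))"
      by (simp only: powr_sum simp_thms)
  qed
  also have "\<dots> = (\<Prod>u\<in>V. \<Prod>v\<in>V. (\<Delta> * y v) powr (a v u / \<Delta>))" by (rule prod.swap)
  also have "(\<Prod>v\<in>V. (d v / exp 1 * x v) powr (1 - expo v)) * \<dots>
      = (\<Prod>u\<in>V. (d u / exp 1 * x u) powr (1 - expo u) * (\<Prod>v\<in>V. (\<Delta> * y v) powr (a v u / \<Delta>)))"
    by (simp add: prod.distrib)
  also have "\<dots> \<le> (\<Prod>u\<in>V. eval_point V x y u)"
  proof (intro prod_mono conjI)
    fix u assume u: "u \<in> V"
    show "0 \<le> (d u / exp 1 * x u) powr (1 - expo u) * (\<Prod>v\<in>V. (\<Delta> * y v) powr (a v u / \<Delta>))"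
      by (intro mult_nonneg_nonneg prod_nonneg) auto
    have "(\<Sum>v\<in>V. a v u / \<Delta>) = expo u" using col[OF u] by (simp add: sum_divide_distrib[symmetric])
    then have "(d u / exp 1 * x u) powr (1 - expo u) * (\<Prod>v\<in>V. (\<Delta> * y v) powr (a v u / \<Delta>))
        \<le> (1 - expo u) * (d u / exp 1 * x u) + (\<Sum>v\<in>V. a v u / \<Delta> * (\<Delta> * y v))"
      using fin u pos a d \<Delta>[OF u] by (intro weighted_arith_geom_mean) auto
    also have "\<dots> = (1 - expo u) * (d u / exp 1) * x u + (\<Sum>v\<in>V. a v u * y v)"
      using \<Delta>[OF u] by (simp add: mult.assoc)
    also have "\<dots> \<le> eval_point V x y u"
      using mult_right_mono[OF c(2)[OF u], of "x u"] u pos by (simp add: eval_point_def less_imp_le)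
    finally show "(d u / exp 1 * x u) powr (1 - expo u) * (\<Prod>v\<in>V. (\<Delta> * y v) powr (a v u / \<Delta>))
        \<le> eval_point V x y u" .
  qed
  also have "\<dots> = multiaff V (mixed_derivative V bordered []) (eval_point V x y)"
    using fin by (simp add: multiaff_def if_distrib[of "\<lambda>t. t * _"] sum.delta cong: if_cong)
  finally show "(\<Prod>v\<in>set []. d v / exp 1)
      * (\<Prod>v\<in>V - set []. weight v * (x v powr (1 - expo v) * y v powr expo v))
    \<le> multiaff V (mixed_derivative V bordered []) (eval_point (V - set []) x y)" by simp
qed

text \<open>The positive coefficient at \<open>V - set vs\<close> persists because each eliminated
  row can take its diagonal entry \<open>c v > 0\<close>. It keeps the derivatives nonzero, as
  preservation of stability and \<open>capacity_step\<close> require.\<close>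

lemma mixed_derivative_invariants:
  assumes "distinct vs" "set vs \<subseteq> V"
  shows "nonneg_homog V (card (V - set vs)) (mixed_derivative V bordered vs)
    \<and> strongly_stable V (mixed_derivative V bordered vs)
    \<and> 0 < mixed_derivative V bordered vs (V - set vs)
    \<and> capacity_bound vs"
  using assms
proof (induction vs)
  case Nil
  have "strongly_stable V (mixed_derivative V bordered [])"
    unfolding strongly_stable_def
  proof (intro allI impI)
    fix z :: "'a \<Rightarrow> complex" assume z: "\<forall>u\<in>V. 0 \<le> Im (z u)"
    have eq: "multiaff V (mixed_derivative V bordered []) z = (\<Prod>u\<in>V. z u)" for z :: "'a \<Rightarrow> 'b::{real_algebra_1,comm_ring_1}"
      using fin by (simp add: multiaff_def if_distrib[of of_real] if_distrib[of "\<lambda>t. t * _"] sum.delta cong: if_cong)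
    have "(\<Prod>u\<in>V. Im (z u)) \<le> (\<Prod>u\<in>V. norm (z u))"
      using z abs_Im_le_cmod by (intro prod_mono) (auto intro: order_trans[OF abs_ge_self])
    then show "multiaff V (mixed_derivative V bordered []) (\<lambda>u. Im (z u)) \<le> norm (multiaff V (mixed_derivative V bordered []) z)"
      unfolding eq by (simp add: prod_norm)
  qed
  moreover have "nonneg_homog V (card (V - set [])) (mixed_derivative V bordered [])" by (simp add: nonneg_homog_def)
  moreover have "0 < mixed_derivative V bordered [] (V - set [])" by simp
  ultimately show ?case using capacity_bound_Nil by blast
next
  case (Cons v vs)
  let ?C = "mixed_derivative V bordered vs" and ?W = "V - set vs" and ?W' = "V - set (v # vs)"
  have v: "v \<in> V" "v \<notin> set vs" using Cons.prems by auto
  have W: "?W = insert v ?W'" "v \<notin> ?W'" using v by auto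
  then have card: "card ?W = Suc (card ?W')" using fin by (metis card_insert_disjoint finite_Diff)
  have "distinct vs" "set vs \<subseteq> V" using Cons.prems by auto
  from Cons.IH[OF this] have hom: "nonneg_homog V (Suc (card ?W')) ?C" and st: "strongly_stable V ?C"
    and pos: "0 < ?C ?W" and cap: "capacity_bound vs"
    unfolding card by blast+
  have bordered: "0 \<le> bordered v u" if "u \<in> V" for u using c(1)[OF v(1)] a by (simp add: less_imp_le)
  define e where "e u = (if u = v then c v else 0)" for u
  have bordered_v: "bordered v = (\<lambda>u. e u + a v u)" by (simp add: fun_eq_iff e_def)
  have e: "0 \<le> e u" "u \<noteq> v \<Longrightarrow> e u = 0" "0 < e v" for u using c(1)[OF v(1)] by (auto simp: e_def)
  have hom': "nonneg_homog V (card ?W') (mixed_derivative V bordered (v # vs))"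
    unfolding mixed_derivative_Cons using bordered by (rule nonneg_homog_dir_deriv[OF fin hom])
  have "dir_deriv V e ?C ?W' = c v * ?C ?W"
  proof -
    have "dir_deriv V e ?C ?W' = (\<Sum>u\<in>{v}. e u * ?C (insert u ?W'))"
      unfolding dir_deriv_def using fin v by (intro sum.mono_neutral_right) (auto simp: e_def)
    then show ?thesis using W by (simp add: e_def del: insert_Diff_single)
  qed
  then have pos_e: "0 < dir_deriv V e ?C ?W'" using pos c(1)[OF v(1)] by simp
  have hom_e: "nonneg_homog V (card ?W') (dir_deriv V e ?C)" and hom_a: "nonneg_homog V (card ?W') (dir_deriv V (a v) ?C)"
    by (rule nonneg_homog_dir_deriv[OF fin hom]; use e a in simp)+
  have pos': "0 < mixed_derivative V bordered (v # vs) ?W'"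
  proof -
    have "0 \<le> dir_deriv V (a v) ?C ?W'" using hom_a by (simp add: nonneg_homog_def)
    then show ?thesis using pos_e unfolding mixed_derivative_Cons bordered_v dir_deriv_add by simp
  qed
  have st': "strongly_stable V (mixed_derivative V bordered (v # vs))"
    unfolding mixed_derivative_Cons
  proof (rule strongly_stable_dir_deriv[OF fin hom st bordered])
    show "dir_deriv V (bordered v) ?C ?W' \<noteq> 0" using pos' unfolding mixed_derivative_Cons by simp
  qed auto
  have "capacity_bound (v # vs)"
    unfolding capacity_bound_def
  proof (intro allI impI)
    fix x y :: "'a \<Rightarrow> real" assume xy: "\<forall>v\<in>V. 0 < x v \<and> 0 < y v"
    define l where "l = eval_point ?W' x y"
    define f0 g0 f1 g1 where "f0 = multiaff V (dir_deriv V e ?C) l" and "g0 = multiaff V ?C l"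
      and "f1 = multiaff V (dir_deriv V (a v) (dir_deriv V e ?C)) l" and "g1 = multiaff V (dir_deriv V (a v) ?C) l"
    have l: "0 \<le> l u" if "u \<in> V" for u
      unfolding l_def eval_point_def using that xy c a
      by (intro add_nonneg_nonneg sum_nonneg) (auto simp: less_imp_le)
    have l_pos: "0 < l u" if "u \<in> ?W'" for u
      unfolding l_def eval_point_def using that xy c a
      by (intro add_pos_nonneg sum_nonneg) (auto simp: less_imp_le)
    have f0: "0 < f0"
      unfolding f0_def using l l_pos pos_e by (intro multiaff_pos[OF fin hom_e, of l ?W']) auto
    have g0: "0 \<le> g0" and g1: "0 \<le> g1"
      unfolding g0_def g1_def using l by (auto intro: multiaff_nonneg[OF hom] multiaff_nonneg[OF hom_a])
    have f1: "0 \<le> f1"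
      unfolding f1_def using l a by (intro multiaff_dir_deriv_nonneg[OF hom_e]) auto
    have rayleigh: "f1 * g0 \<le> f0 * g1"
    \<comment> \<open>The Rayleigh inequality was proved only at points of positive value; for
      \<open>g0 = 0\<close> the left side vanishes.\<close>
    proof (cases "g0 = 0")
      case False
      then show ?thesis
        using g0 l a e multiaff_rayleigh[OF fin hom st, of l "a v" v e]
        by (simp add: f0_def g0_def f1_def g1_def less_le)
    qed (use f0 g1 in simp)
    have at_e: "multiaff V ?C (\<lambda>u. l u + X * e u) = g0 + X * f0"
      "multiaff V (dir_deriv V (a v) ?C) (\<lambda>u. l u + X * e u) = g1 + X * f1" for X
      using multiaff_add_single[OF fin, of v e _ l X] e(2)
      by (simp_all add: g0_def f0_def g1_def f1_def dir_deriv_commute[OF fin, of e])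
    define K where "K = (\<Prod>v\<in>set vs. d v / exp 1)
      * (\<Prod>w\<in>?W'. weight w * (x w powr (1 - expo w) * y w powr expo w)) * weight v"
    have nz: "d w \<noteq> 0" "\<Delta> \<noteq> 0" "x w \<noteq> 0" "y w \<noteq> 0" if "w \<in> V" for w
      using d[OF that] xy that by force+
    have "0 < (\<Prod>v\<in>set vs. d v / exp 1)"
      using Cons.prems d(1) by (intro prod_pos) auto
    moreover have "0 < (\<Prod>w\<in>?W'. weight w * (x w powr (1 - expo w) * y w powr expo w))"
    proof (rule prod_pos)
      fix w assume "w \<in> ?W'"
      then show "0 < weight w * (x w powr (1 - expo w) * y w powr expo w)" using nz[of w] by simp
    qed
    moreover have "0 < weight v" using nz[OF v(1)] by simp
    ultimately have K: "0 < K" unfolding K_def by simp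
    have "K * (expo v / exp 1) powr expo v \<le> f0 + g1"
    proof (rule capacity_step[OF f0 g0 f1 g1 rayleigh _ _ K])
      show "0 < expo v" "expo v \<le> 1" using d[OF v(1)] by (auto simp: field_simps)
      \<comment> \<open>With the variables of the other rows frozen, the point of the bound for
        \<open>vs\<close> is \<open>l + X e + Y a_v\<close>, so the variables of \<open>v\<close>
        become the two variables of \<open>capacity_step\<close>.\<close>
      fix X Y :: real assume XY: "0 < X" "0 < Y"
      have "K * (X powr (1 - expo v) * Y powr expo v) = (\<Prod>v\<in>set vs. d v / exp 1)
          * (\<Prod>w\<in>?W. weight w * ((x(v := X)) w powr (1 - expo w) * (y(v := Y)) w powr expo w))"
      proof -
        have "(\<Prod>w\<in>?W'. weight w * ((x(v := X)) w powr (1 - expo w) * (y(v := Y)) w powr expo w))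
            = (\<Prod>w\<in>?W'. weight w * (x w powr (1 - expo w) * y w powr expo w))"
          by (intro prod.cong) auto
        then show ?thesis unfolding W(1) using W(2) fin by (simp add: K_def mult_ac del: insert_Diff_single)
      qed
      also have "\<dots> \<le> multiaff V ?C (eval_point ?W (x(v := X)) (y(v := Y)))"
      proof -
        have "\<forall>w\<in>V. 0 < (x(v := X)) w \<and> 0 < (y(v := Y)) w" using xy XY by simp
        then show ?thesis using cap unfolding capacity_bound_def by blast
      qed
      also have "eval_point ?W (x(v := X)) (y(v := Y)) = (\<lambda>u. (l u + X * e u) + Y * a v u)"
      proof
        fix u
        have "(\<Sum>w\<in>?W'. a w u * (y(v := Y)) w) = (\<Sum>w\<in>?W'. a w u * y w)"
          by (intro sum.cong) auto
        then show "eval_point ?W (x(v := X)) (y(v := Y)) u = (l u + X * e u) + Y * a v u"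
          unfolding eval_point_def l_def W(1) using W(2) fin
          by (auto simp: e_def mult_ac simp del: insert_Diff_single)
      qed
      also have "multiaff V ?C \<dots> \<le> (g0 + X * f0) * exp (Y * (g1 + X * f1) / (g0 + X * f0))"
        unfolding at_e[symmetric]
        by (rule multiaff_line_le_exp[OF fin hom st])
           (use l e a XY f0 g0 in \<open>auto simp: at_e add_nonneg_pos less_imp_le intro!: add_nonneg_nonneg\<close>)
      finally show "K * (X powr (1 - expo v) * Y powr expo v)
          \<le> (g0 + X * f0) * exp (Y * (g1 + X * f1) / (g0 + X * f0))" .
    qed
    moreover have "weight v * (expo v / exp 1) powr expo v = d v / exp 1"
    proof -
      have "\<Delta> powr expo v * (expo v / exp 1) powr expo v = (d v / exp 1) powr expo v"
        using d[OF v(1)] by (subst powr_mult[symmetric]) auto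
      then show ?thesis using d[OF v(1)] by (simp add: mult.assoc powr_add[symmetric])
    qed
    ultimately have "(\<Prod>v\<in>set vs. d v / exp 1)
        * (\<Prod>w\<in>?W'. weight w * (x w powr (1 - expo w) * y w powr expo w)) * (d v / exp 1) \<le> f0 + g1"
      unfolding K_def by (simp only: mult.assoc)
    then show "(\<Prod>v\<in>set (v # vs). d v / exp 1)
        * (\<Prod>v\<in>?W'. weight v * (x v powr (1 - expo v) * y v powr expo v))
      \<le> multiaff V (mixed_derivative V bordered (v # vs)) (eval_point ?W' x y)"
      unfolding mixed_derivative_Cons bordered_v dir_deriv_add[abs_def] multiaff_add_coeff
      using v by (simp add: f0_def g1_def l_def mult_ac)
  qed
  then show ?case using hom' st' pos' by blast
qed

lemma permanent_lower_bound: "(\<Prod>v\<in>V. d v / exp 1) \<le> permanent V bordered"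
proof -
  obtain vs where vs: "set vs = V" "distinct vs" using finite_distinct_list[OF fin] by blast
  then have "nonneg_homog V 0 (mixed_derivative V bordered vs)" "capacity_bound vs"
    using mixed_derivative_invariants[of vs] by auto
  then have "(\<Prod>v\<in>V. d v / exp 1) \<le> multiaff V (mixed_derivative V bordered vs) (eval_point {} (\<lambda>_. 1) (\<lambda>_. 1))"
    using vs(1) \<open>capacity_bound vs\<close>[unfolded capacity_bound_def, rule_format, of "\<lambda>_. 1" "\<lambda>_. 1"]
    by simp
  \<comment> \<open>\<open>eval_point {}\<close> is the zero vector, so only the constant
    coefficient survives.\<close>
  also have "\<dots> = (\<Sum>U\<in>{{}}. mixed_derivative V bordered vs U)"
    unfolding multiaff_def using fin
    by (intro sum.mono_neutral_cong_right) (auto simp: eval_point_def prod_zero_iff finite_subset)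
  also have "\<dots> = permanent V bordered" using mixed_derivative_eq_permanent[OF fin vs(2,1)] by simp
  finally show ?thesis .
qed

end

section \<open>Hadamard's inequality\<close>

text \<open>An orthogonal factor on the right changes neither the row norms nor the squared
  determinant, which makes a row expansion with a single term available to Hadamard's
  inequality.\<close>

lemma exists_isometry_aligning_row:
  fixes A :: "real mat"
  assumes A: "A \<in> carrier_mat n n" and n: "0 < n"
  obtains B where "B \<in> carrier_mat n n" "(det B)\<^sup>2 = (det A)\<^sup>2"
    "\<And>i. i < n \<Longrightarrow> (\<Sum>j<n. (B $$ (i, j))\<^sup>2) = (\<Sum>j<n. (A $$ (i, j))\<^sup>2)"
    "\<And>j. 0 < j \<Longrightarrow> j < n \<Longrightarrow> B $$ (0, j) = 0"
proof -
  define x where "x j = A $$ (0, j)" for j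
  define s where "s = sqrt (\<Sum>j<n. (x j)\<^sup>2)"
  have s2: "s\<^sup>2 = (\<Sum>j<n. (x j)\<^sup>2)" by (simp add: s_def sum_nonneg)
  define v where "v j = x j - (if j = 0 then s else 0)" for j
  define N where "N = (\<Sum>j<n. (v j)\<^sup>2)"
  show ?thesis
  \<comment> \<open>If \<open>N = 0\<close>, the first row is already \<open>s\<close> times the
    first unit vector and no reflection is defined.\<close>
  proof (cases "N = 0")
    case True
    then have "v j = 0" if "j < n" for j
      using that by (auto simp: N_def sum_nonneg_eq_0_iff)
    then have "A $$ (0, j) = 0" if "0 < j" "j < n" for j using that by (simp add: v_def x_def)
    then show ?thesis using that[of A] A by auto
  next
    case False
    define dot where "dot i = (\<Sum>l<n. A $$ (i, l) * v l)" for i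
    \<comment> \<open>the Householder reflection taking the first row to a multiple of the first unit vector\<close>
    define H where "H = mat n n (\<lambda>(i, j). (if i = j then 1 else 0) - 2 / N * v i * v j)"
    define B where "B = A * H"
    have H: "H \<in> carrier_mat n n" by (simp add: H_def)
    have B_entry: "B $$ (i, j) = A $$ (i, j) - 2 / N * dot i * v j" if "i < n" "j < n" for i j
    proof -
      have "B $$ (i, j) = (\<Sum>l<n. A $$ (i, l) * ((if l = j then 1 else 0) - 2 / N * v l * v j))"
        using that A by (simp add: B_def H_def scalar_prod_def lessThan_atLeast0)
      also have "\<dots> = (\<Sum>l<n. (if l = j then A $$ (i, l) else 0) - 2 / N * v j * (A $$ (i, l) * v l))"
        by (intro sum.cong) (auto simp: algebra_simps)
      also have "\<dots> = A $$ (i, j) - 2 / N * v j * dot i"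
        using that by (simp add: sum_subtractf dot_def sum_distrib_left sum_divide_distrib)
      finally show ?thesis by (simp add: mult_ac)
    qed
    have "H * H = 1\<^sub>m n"
    proof (rule eq_matI)
      fix i j assume "i < dim_row (1\<^sub>m n :: real mat)" "j < dim_col (1\<^sub>m n :: real mat)"
      then have ij: "i < n" "j < n" by auto
      have "(H * H) $$ (i, j) = (\<Sum>l<n. ((if i = l then 1 else 0) - 2 / N * v i * v l)
          * ((if l = j then 1 else 0) - 2 / N * v l * v j))"
        using ij by (simp add: H_def scalar_prod_def lessThan_atLeast0)
      also have "\<dots> = (\<Sum>l<n. (if i = l then if l = j then 1 else 0 else 0)
          - (if i = l then 2 / N * v l * v j else 0) - (if l = j then 2 / N * v i * v l else 0)
          + 4 / N\<^sup>2 * v i * v j * (v l)\<^sup>2)"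
        by (intro sum.cong) (auto simp: algebra_simps power2_eq_square)
      also have "\<dots> = (if i = j then 1 else 0) - 2 / N * v i * v j - 2 / N * v i * v j + 4 / N\<^sup>2 * v i * v j * N"
      proof -
        have "(\<Sum>l<n. 4 / N\<^sup>2 * v i * v j * (v l)\<^sup>2) = 4 / N\<^sup>2 * v i * v j * N"
          unfolding sum_distrib_left[symmetric] by (simp only: N_def)
        then show ?thesis using ij by (simp only: sum.distrib sum_subtractf) simp
      qed
      also have "4 / N\<^sup>2 * v i * v j * N = 4 / N * v i * v j" using False by (simp add: power2_eq_square)
      finally show "(H * H) $$ (i, j) = 1\<^sub>m n $$ (i, j)" using ij by simp
    qed (simp_all add: H_def)
    then have "det H * det H = 1" using det_mult[OF H H] by simp
    then have "(det B)\<^sup>2 = (det A)\<^sup>2"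
      by (simp add: B_def det_mult[OF A H] power2_eq_square mult_ac)
    moreover have "(\<Sum>j<n. (B $$ (i, j))\<^sup>2) = (\<Sum>j<n. (A $$ (i, j))\<^sup>2)" if "i < n" for i
    proof -
      have "(\<Sum>j<n. (B $$ (i, j))\<^sup>2)
          = (\<Sum>j<n. (A $$ (i, j))\<^sup>2 - 4 / N * dot i * (A $$ (i, j) * v j) + (2 / N * dot i)\<^sup>2 * (v j)\<^sup>2)"
        by (intro sum.cong refl) (simp add: B_entry[OF that] power2_eq_square algebra_simps)
      also have "\<dots> = (\<Sum>j<n. (A $$ (i, j))\<^sup>2) - 4 / N * dot i * dot i + (2 / N * dot i)\<^sup>2 * N"
      proof -
        have "(\<Sum>j<n. 4 / N * dot i * (A $$ (i, j) * v j)) = 4 / N * dot i * dot i"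
          unfolding sum_distrib_left[symmetric] by (simp only: dot_def)
        moreover have "(\<Sum>j<n. (2 / N * dot i)\<^sup>2 * (v j)\<^sup>2) = (2 / N * dot i)\<^sup>2 * N"
          unfolding sum_distrib_left[symmetric] by (simp only: N_def)
        ultimately show ?thesis by (simp only: sum.distrib sum_subtractf)
      qed
      also have "4 / N * dot i * dot i = (2 / N * dot i)\<^sup>2 * N"
        using False by (simp add: power2_eq_square)
      finally show ?thesis by simp
    qed
    moreover have "B $$ (0, j) = 0" if "0 < j" "j < n" for j
    proof -
      have delta: "(\<Sum>l<n. x l * (if l = 0 then s else 0)) = x 0 * s"
        "(\<Sum>l<n. if l = 0 then s\<^sup>2 else 0) = s\<^sup>2"
        using n by (simp_all add: if_distrib[of "\<lambda>t. _ * t"] cong: if_cong)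
      \<comment> \<open>The first row and its target have the same length \<open>s\<close>, so
        \<open>N = 2 * dot 0\<close> and the reflection subtracts exactly \<open>v\<close> from the
        first row.\<close>
      have "N = (\<Sum>l<n. (x l)\<^sup>2 - 2 * (x l * (if l = 0 then s else 0)) + (if l = 0 then s\<^sup>2 else 0))"
        unfolding N_def v_def by (intro sum.cong) (auto simp: power2_eq_square algebra_simps)
      also have "\<dots> = 2 * (s\<^sup>2 - x 0 * s)"
        by (simp add: sum.distrib sum_subtractf sum_distrib_left[symmetric] delta s2)
      also have "s\<^sup>2 - x 0 * s = (\<Sum>l<n. (x l)\<^sup>2 - x l * (if l = 0 then s else 0))"
        by (simp add: sum_subtractf delta s2)
      also have "\<dots> = dot 0"
        unfolding dot_def v_def x_def[symmetric]
        by (intro sum.cong) (auto simp: power2_eq_square algebra_simps)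
      finally have "2 / N * dot 0 = 1" using False by simp
      then show ?thesis using B_entry[of 0 j] that by (simp add: v_def x_def)
    qed
    ultimately show ?thesis using that[of B] A H by (simp add: B_def)
  qed
qed

text \<open>Once the first row is aligned, the determinant is its first entry times a minor, and
  deleting the first column only shortens the remaining rows.\<close>

lemma hadamard_mat:
  fixes A :: "real mat"
  assumes "A \<in> carrier_mat n n"
  shows "(det A)\<^sup>2 \<le> (\<Prod>i<n. \<Sum>j<n. (A $$ (i, j))\<^sup>2)"
  using assms
proof (induction n arbitrary: A)
  case 0
  then show ?case by (simp add: det_dim_zero)
next
  case (Suc n)
  obtain B where B: "B \<in> carrier_mat (Suc n) (Suc n)" and det: "(det B)\<^sup>2 = (det A)\<^sup>2"
    and rows: "\<And>i. i < Suc n \<Longrightarrow> (\<Sum>j<Suc n. (B $$ (i, j))\<^sup>2) = (\<Sum>j<Suc n. (A $$ (i, j))\<^sup>2)"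
    and zero: "\<And>j. 0 < j \<Longrightarrow> j < Suc n \<Longrightarrow> B $$ (0, j) = 0"
    using exists_isometry_aligning_row[OF Suc.prems] by auto
  let ?D = "mat_delete B 0 0"
  have D: "?D \<in> carrier_mat n n" using mat_delete_carrier[OF B] by simp
  have entry: "?D $$ (i, j) = B $$ (Suc i, Suc j)" if "i < n" "j < n" for i j
    using mat_delete_index[OF B, of 0 0 i j] that by (simp add: insert_index_def)
  have "det B = (\<Sum>j<Suc n. B $$ (0, j) * cofactor B 0 j)" by (rule laplace_expansion_row[OF B]) simp
  also have "\<dots> = B $$ (0, 0) * det ?D"
    by (simp only: sum.lessThan_Suc_shift) (simp add: zero cofactor_def)
  finally have "(det A)\<^sup>2 = (B $$ (0, 0))\<^sup>2 * (det ?D)\<^sup>2"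
    using det by (simp add: power_mult_distrib)
  also have "\<dots> \<le> (\<Sum>j<Suc n. (B $$ (0, j))\<^sup>2) * (\<Prod>i<n. \<Sum>j<Suc n. (B $$ (Suc i, j))\<^sup>2)"
  proof (intro mult_mono)
    show "(B $$ (0, 0))\<^sup>2 \<le> (\<Sum>j<Suc n. (B $$ (0, j))\<^sup>2)"
      by (rule member_le_sum[of 0 "{..<Suc n}"]) auto
    have "(det ?D)\<^sup>2 \<le> (\<Prod>i<n. \<Sum>j<n. (?D $$ (i, j))\<^sup>2)" by (rule Suc.IH[OF D])
    also have "\<dots> \<le> (\<Prod>i<n. \<Sum>j<Suc n. (B $$ (Suc i, j))\<^sup>2)"
      by (intro prod_mono conjI sum_nonneg) (auto simp: entry sum.lessThan_Suc_shift simp del: sum.lessThan_Suc)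
    finally show "(det ?D)\<^sup>2 \<le> (\<Prod>i<n. \<Sum>j<Suc n. (B $$ (Suc i, j))\<^sup>2)" .
  qed (auto intro!: sum_nonneg add_nonneg_nonneg)
  also have "\<dots> = (\<Prod>i<Suc n. \<Sum>j<Suc n. (B $$ (i, j))\<^sup>2)"
    by (simp only: prod.lessThan_Suc_shift)
  also have "\<dots> = (\<Prod>i<Suc n. \<Sum>j<Suc n. (A $$ (i, j))\<^sup>2)" by (intro prod.cong rows) auto
  finally show ?case .
qed

theorem hadamard:
  fixes M :: "'a \<Rightarrow> 'a \<Rightarrow> real"
  assumes fin: "finite S"
  shows "(\<Sum>p | p permutes S. of_int (sign p) * (\<Prod>i\<in>S. M i (p i)))\<^sup>2 \<le> (\<Prod>i\<in>S. \<Sum>j\<in>S. (M i j)\<^sup>2)"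
proof -
  obtain e where e: "bij_betw e {0..<card S} S" using ex_bij_betw_nat_finite[OF fin] by blast
  let ?n = "card S" and ?e' = "inv_into {0..<card S} e"
  let ?A = "mat ?n ?n (\<lambda>(i, j). M (e i) (e j))"
  have e': "bij_betw ?e' S {0..<?n}" by (rule bij_betw_inv_into[OF e])
  have inj: "inj_on e {0..<?n}" using e by (rule bij_betw_imp_inj_on)
  have "det ?A = (\<Sum>p | p permutes {0..<?n}. signof p * (\<Prod>i = 0..<?n. ?A $$ (i, p i)))"
    by (rule det_def'[of _ ?n]) simp
  also have "\<dots> = (\<Sum>p | p permutes S. of_int (sign p) * (\<Prod>i\<in>S. M i (p i)))"
  proof (rule sum.reindex_bij_witness[of _ "map_permutation S ?e'" "map_permutation {0..<?n} e"])
    fix p assume "p \<in> {p. p permutes {0..<?n}}"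
    then have p: "p permutes {0..<?n}" by simp
    show "map_permutation {0..<?n} e p \<in> {p. p permutes S}"
      using map_permutation_permutes[OF e p] by simp
    show "map_permutation S ?e' (map_permutation {0..<?n} e p) = p"
      by (rule map_permutation_compose_inv[OF e p]) (simp add: inj)
    have "(\<Prod>i\<in>S. M i (map_permutation {0..<?n} e p i))
        = (\<Prod>i = 0..<?n. M (e i) (map_permutation {0..<?n} e p (e i)))"
      by (rule prod.reindex_bij_betw[OF e, symmetric])
    also have "\<dots> = (\<Prod>i = 0..<?n. ?A $$ (i, p i))"
      using permutes_in_image[OF p] by (intro prod.cong) (auto simp: map_permutation_apply[OF inj])
    finally show "of_int (sign (map_permutation {0..<?n} e p)) * (\<Prod>i\<in>S. M i (map_permutation {0..<?n} e p i))
        = signof p * (\<Prod>i = 0..<?n. ?A $$ (i, p i))"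
      by (simp add: sign_map_permutation[OF inj p])
  next
    fix p assume "p \<in> {p. p permutes S}"
    then have p: "p permutes S" by simp
    show "map_permutation S ?e' p \<in> {p. p permutes {0..<?n}}"
      using map_permutation_permutes[OF e' p] by simp
    show "map_permutation {0..<?n} e (map_permutation S ?e' p) = p"
      by (rule map_permutation_compose_inv[OF e' p])
         (use e in \<open>auto simp: bij_betw_def f_inv_into_f\<close>)
  qed
  finally have "(\<Sum>p | p permutes S. of_int (sign p) * (\<Prod>i\<in>S. M i (p i)))\<^sup>2 = (det ?A)\<^sup>2" by simp
  also have "\<dots> \<le> (\<Prod>i<?n. \<Sum>j<?n. (?A $$ (i, j))\<^sup>2)" by (rule hadamard_mat) simp
  also have "\<dots> = (\<Prod>i = 0..<?n. \<Sum>j = 0..<?n. (M (e i) (e j))\<^sup>2)"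
    by (simp add: lessThan_atLeast0)
  also have "\<dots> = (\<Prod>i\<in>S. \<Sum>j\<in>S. (M i j)\<^sup>2)"
    unfolding sum.reindex_bij_betw[OF e, of "\<lambda>j. (M _ j)\<^sup>2"]
    by (rule prod.reindex_bij_betw[OF e])
  finally show ?thesis .
qed

section \<open>Potentials\<close>

lemma sum_PiE_insert:
  assumes "v \<notin> S"
  shows "(\<Sum>h\<in>insert v S \<rightarrow>\<^sub>E C. F h) = (\<Sum>h\<in>S \<rightarrow>\<^sub>E C. \<Sum>g\<in>C. F (h(v := g)))"
proof -
  have "(\<Sum>h\<in>insert v S \<rightarrow>\<^sub>E C. F h) = (\<Sum>(g, h)\<in>C \<times> (S \<rightarrow>\<^sub>E C). F (h(v := g)))"
    unfolding PiE_insert_eq by (subst sum.reindex[OF inj_combinator[OF assms]]) (simp add: case_prod_unfold)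
  also have "\<dots> = (\<Sum>g\<in>C. \<Sum>h\<in>S \<rightarrow>\<^sub>E C. F (h(v := g)))" by (simp add: sum.cartesian_product)
  also have "\<dots> = (\<Sum>h\<in>S \<rightarrow>\<^sub>E C. \<Sum>g\<in>C. F (h(v := g)))" by (rule sum.swap)
  finally show ?thesis .
qed

context group
begin

text \<open>A potential of a labelled functional graph \<open>f\<close> on \<open>T\<close> exists iff all cycles of \<open>f\<close> have trivial
  label product.\<close>

definition potential :: "('v \<Rightarrow> 'v) \<Rightarrow> ('v \<Rightarrow> 'a) \<Rightarrow> 'v set \<Rightarrow> ('v \<Rightarrow> 'a) \<Rightarrow> bool" where
  "potential f lab T h \<longleftrightarrow> h \<in> T \<rightarrow> carrier G \<and> (\<forall>u\<in>T. h (f u) = h u \<otimes> lab u)"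

text \<open>For \<open>T\<close> a single cycle of \<open>f\<close> this forbids a trivial label
  product, without ordering the cycle or choosing its initial vertex. Closed sets rather than cycles
  are convenient under contraction.\<close>

definition no_potential :: "('v \<Rightarrow> 'v) \<Rightarrow> ('v \<Rightarrow> 'a) \<Rightarrow> 'v set \<Rightarrow> bool" where
  "no_potential f lab S \<longleftrightarrow> (\<forall>T h. T \<subseteq> S \<and> T \<noteq> {} \<and> f ` T \<subseteq> T \<longrightarrow> \<not> potential f lab T h)"

lemma no_potential_subset: "no_potential f lab S \<Longrightarrow> T \<subseteq> S \<Longrightarrow> no_potential f lab T"
  unfolding no_potential_def by blast

lemma no_potentialD:
  "no_potential f lab S \<Longrightarrow> potential f lab T h \<Longrightarrow> T \<subseteq> S \<Longrightarrow> T \<noteq> {} \<Longrightarrow> f ` T \<subseteq> T \<Longrightarrow> False"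
  unfolding no_potential_def by blast

context
  assumes fin: "finite (carrier G)"
begin

abbreviation k where "k \<equiv> real (order G)"

lemma k_pos: "0 < k"
  using fin by (simp add: Coset.order_def card_gt_0_iff carrier_not_empty)

lemma sum_of_bool_eq: "p \<in> carrier G \<Longrightarrow> (\<Sum>g\<in>carrier G. of_bool (g = p)) = (1::real)"
  using fin by (simp add: of_bool_def sum.delta)

lemma sum_of_bool_eq_mult:
  assumes "q \<in> carrier G" "r \<in> carrier G"
  shows "(\<Sum>g\<in>carrier G. of_bool (q = g \<otimes> r)) = (1::real)"
proof -
  have "(q = g \<otimes> r) = (g = q \<otimes> inv r)" if "g \<in> carrier G" for g
    using assms that by (metis inv_solve_right m_closed inv_closed)
  then have "(\<Sum>g\<in>carrier G. of_bool (q = g \<otimes> r)) = (\<Sum>g\<in>carrier G. of_bool (g = q \<otimes> inv r) :: real)"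
    by (intro sum.cong) auto
  then show ?thesis using sum_of_bool_eq[of "q \<otimes> inv r"] assms by simp
qed

text \<open>The kernels \<open>of_bool (q = p \<otimes> r) - 1 / k\<close> represent \<open>r\<close> on the functions of mean zero.\<close>

lemma kernel_mult:
  assumes "p \<in> carrier G" "q \<in> carrier G" "r \<in> carrier G"
  shows "(\<Sum>g\<in>carrier G. (of_bool (g = p) - 1 / k) * (of_bool (q = g \<otimes> r) - 1 / k))
    = of_bool (q = p \<otimes> r) - 1 / k"
proof -
  have "(\<Sum>g\<in>carrier G. (of_bool (g = p) - 1 / k) * (of_bool (q = g \<otimes> r) - 1 / k))
      = (\<Sum>g\<in>carrier G. of_bool (g = p) * of_bool (q = p \<otimes> r)
          - 1 / k * of_bool (g = p) - 1 / k * of_bool (q = g \<otimes> r) + 1 / k\<^sup>2)"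
    by (intro sum.cong refl) (auto simp: algebra_simps power2_eq_square)
  also have "\<dots> = (\<Sum>g\<in>carrier G. of_bool (g = p)) * of_bool (q = p \<otimes> r)
      - 1 / k * (\<Sum>g\<in>carrier G. of_bool (g = p)) - 1 / k * (\<Sum>g\<in>carrier G. of_bool (q = g \<otimes> r))
      + (\<Sum>g\<in>carrier G. 1 / k\<^sup>2)"
    unfolding sum.distrib sum_subtractf sum_distrib_left sum_distrib_right ..
  also have "\<dots> = of_bool (q = p \<otimes> r) - 1 / k"
    unfolding sum_of_bool_eq[OF assms(1)] sum_of_bool_eq_mult[OF assms(2,3)]
    using k_pos by (simp add: Coset.order_def power2_eq_square)
  finally show ?thesis .
qed

text \<open>Induction by contracting \<open>v\<close> out of its cycle. A fixed point has a
  nontrivial label, so summing its factor \<open>- 1 / k\<close> over the group gives -1. Otherwise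
  \<open>kernel_mult\<close> merges the factors of \<open>v\<close> and its predecessor; both
  \<open>(-1) ^ card S\<close> and the sign flip.\<close>

lemma sum_kernels_permutation:
  assumes "finite S" "\<sigma> permutes S" "lab \<in> S \<rightarrow> carrier G" "no_potential \<sigma> lab S"
  shows "(\<Sum>h\<in>S \<rightarrow>\<^sub>E carrier G. \<Prod>u\<in>S. of_bool (h (\<sigma> u) = h u \<otimes> lab u) - 1 / k)
    = (-1) ^ card S * of_int (sign \<sigma>)"
  using assms
proof (induction S arbitrary: \<sigma> lab)
  case empty
  then show ?case by simp
next
  case (insert v S \<sigma> lab)
  \<comment> \<open>\<open>\<tau>\<close> bypasses \<open>v\<close>: it sends the predecessor of
    \<open>v\<close> to \<open>\<sigma> v\<close> and fixes \<open>v\<close>.\<close>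
  define \<tau> where "\<tau> = Transposition.transpose v (\<sigma> v) \<circ> \<sigma>"
  have \<tau>: "\<tau> permutes S" unfolding \<tau>_def using insert.prems(1) by (rule permutes_insert_lemma)
  have inj: "inj \<sigma>" using insert.prems(1) by (rule permutes_inj)
  have perm: "permutation \<sigma>"
    using insert.prems(1) insert.hyps(1) permutation_permutes by blast
  have sign: "sign \<tau> = (if \<sigma> v = v then 1 else -1) * sign \<sigma>"
    unfolding \<tau>_def using perm by (simp add: sign_compose permutation_swap_id sign_swap_id)
  let ?C = "carrier G"
  have lab: "lab u \<in> ?C" if "u \<in> insert v S" for u using insert.prems(2) that by auto
  then have lv: "lab v \<in> ?C" by simp
  show ?case
  proof (cases "\<sigma> v = v")
    case True
    have v: "lab v \<noteq> \<one>"
    proof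
      assume "lab v = \<one>"
      then have "potential \<sigma> lab {v} (\<lambda>_. \<one>)" by (simp add: potential_def)
      then show False using no_potentialD[OF insert.prems(3), of "{v}"] True by simp
    qed
    have \<sigma>: "\<tau> = \<sigma>" unfolding \<tau>_def True by simp
    have IH: "(\<Sum>h\<in>S \<rightarrow>\<^sub>E ?C. \<Prod>u\<in>S. of_bool (h (\<sigma> u) = h u \<otimes> lab u) - 1 / k)
        = (-1) ^ card S * of_int (sign \<sigma>)"
      using \<tau> lab no_potential_subset[OF insert.prems(3)] unfolding \<sigma>
      by (intro insert.IH) auto
    have "(\<Sum>h\<in>insert v S \<rightarrow>\<^sub>E ?C. \<Prod>u\<in>insert v S. of_bool (h (\<sigma> u) = h u \<otimes> lab u) - 1 / k)
        = (\<Sum>h\<in>S \<rightarrow>\<^sub>E ?C. \<Sum>g\<in>?C. (- 1 / k) * (\<Prod>u\<in>S. of_bool (h (\<sigma> u) = h u \<otimes> lab u) - 1 / k))"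
      unfolding sum_PiE_insert[OF insert.hyps(2)]
    proof (intro sum.cong refl)
      fix h g assume g: "g \<in> ?C"
      have "g \<noteq> g \<otimes> lab v" using g v lv by simp
      moreover have "(\<Prod>u\<in>S. of_bool ((h(v := g)) (\<sigma> u) = (h(v := g)) u \<otimes> lab u) - 1 / k)
          = (\<Prod>u\<in>S. of_bool (h (\<sigma> u) = h u \<otimes> lab u) - 1 / k)"
      proof (rule prod.cong[OF refl])
        fix u assume "u \<in> S"
        then have "\<sigma> u \<noteq> v" "u \<noteq> v"
          using insert.hyps(2) permutes_in_image[OF \<tau>, of u] unfolding \<sigma> by auto
        then show "of_bool ((h(v := g)) (\<sigma> u) = (h(v := g)) u \<otimes> lab u) - 1 / k
            = of_bool (h (\<sigma> u) = h u \<otimes> lab u) - 1 / k" by simp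
      qed
      ultimately show "(\<Prod>u\<in>insert v S. of_bool ((h(v := g)) (\<sigma> u) = (h(v := g)) u \<otimes> lab u) - 1 / k)
          = (- 1 / k) * (\<Prod>u\<in>S. of_bool (h (\<sigma> u) = h u \<otimes> lab u) - 1 / k)"
        using insert.hyps True by simp
    qed
    also have "\<dots> = - (\<Sum>h\<in>S \<rightarrow>\<^sub>E ?C. \<Prod>u\<in>S. of_bool (h (\<sigma> u) = h u \<otimes> lab u) - 1 / k)"
      using k_pos by (simp add: sum_negf Coset.order_def)
    finally show ?thesis using insert.hyps by (simp add: IH)
  next
    case False
    define w x where "w = Hilbert_Choice.inv \<sigma> v" and "x = \<sigma> v"
    have \<sigma>w: "\<sigma> w = v" unfolding w_def using permutes_inverses(1)[OF insert.prems(1)] .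
    have "\<sigma> w \<in> insert v S" "\<sigma> v \<in> insert v S"
      using permutes_in_image[OF insert.prems(1)] \<sigma>w by auto
    then have w: "w \<in> S" "w \<noteq> v" and x: "x \<in> S" "x \<noteq> v"
      using permutes_in_image[OF insert.prems(1), of w] False \<sigma>w by (auto simp: x_def)
    have \<tau>w: "\<tau> w = x" by (simp add: \<tau>_def \<sigma>w x_def)
    have \<tau>_other: "\<tau> u = \<sigma> u" "\<sigma> u \<noteq> v" if "u \<noteq> v" "u \<noteq> w" for u
      using that \<sigma>w inj by (auto simp: \<tau>_def Transposition.transpose_def inj_eq)
    have lw: "lab w \<in> ?C" using lab w by simp
    define lab' where "lab' = lab(w := lab w \<otimes> lab v)"
    \<comment> \<open>A potential of the contracted graph extends to \<open>v\<close> by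
      \<open>h w \<otimes> lab w\<close> if the set contains \<open>w\<close>; otherwise it is
      already one for \<open>\<sigma>\<close>.\<close>
    have "no_potential \<tau> lab' S"
      unfolding no_potential_def
    proof (intro allI impI notI)
      fix T h assume T: "T \<subseteq> S \<and> T \<noteq> {} \<and> \<tau> ` T \<subseteq> T" and pot: "potential \<tau> lab' T h"
      have vT: "v \<notin> T" using T insert.hyps(2) by auto
      show False
      proof (cases "w \<in> T")
        case True
        let ?h = "h(v := h w \<otimes> lab w)"
        have hw: "h w \<in> ?C" "x \<in> T" using pot True T \<tau>w by (auto simp: potential_def)
        have "h x = h w \<otimes> lab w \<otimes> lab v"
          using pot True \<tau>w hw lw lv by (auto simp: potential_def lab'_def m_assoc)
        moreover have other: "h (\<sigma> u) = h u \<otimes> lab u" if "u \<in> T" "u \<noteq> w" for u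
        proof -
          have "\<tau> u = \<sigma> u" using \<tau>_other[of u] that vT by auto
          then show ?thesis using pot that by (auto simp: potential_def lab'_def)
        qed
        ultimately have "?h (\<sigma> u) = ?h u \<otimes> lab u" if u: "u \<in> insert v T" for u
        proof -
          consider "u = v" | "u = w" | "u \<in> T" "u \<noteq> v" "u \<noteq> w" using u by blast
          then show ?thesis
          proof cases
            case 1
            then show ?thesis using \<open>h x = h w \<otimes> lab w \<otimes> lab v\<close> x by (simp add: x_def)
          next
            case 2
            then show ?thesis using \<sigma>w w by simp
          next
            case 3
            then show ?thesis using other[of u] \<tau>_other[of u] by simp
          qed
        qed
        moreover have "?h \<in> insert v T \<rightarrow> ?C" using pot hw lw by (auto simp: potential_def)
        ultimately have "potential \<sigma> lab (insert v T) ?h" unfolding potential_def by blast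
        moreover have "\<sigma> u \<in> insert v T" if "u \<in> insert v T" for u
        proof (cases "u = v \<or> u = w")
          case True
          then show ?thesis using hw \<sigma>w by (auto simp: x_def)
        next
          case False
          then have "\<tau> u = \<sigma> u" "u \<in> T" using that \<tau>_other[of u] by auto
          then show ?thesis using T by force
        qed
        then have "\<sigma> ` insert v T \<subseteq> insert v T" by blast
        ultimately show False
          using no_potentialD[OF insert.prems(3), of "insert v T" ?h] T by blast
      next
        case False
        have eq: "\<sigma> u = \<tau> u" "lab' u = lab u" if "u \<in> T" for u
        proof -
          have "u \<noteq> v" "u \<noteq> w" using that False vT by auto
          then show "\<sigma> u = \<tau> u" "lab' u = lab u" using \<tau>_other[of u] by (auto simp: lab'_def)
        qed
        then have "potential \<sigma> lab T h" using pot by (simp add: potential_def)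
        moreover have "\<sigma> ` T \<subseteq> T" using T eq by auto
        ultimately show False using no_potentialD[OF insert.prems(3), of T h] T by blast
      qed
    qed
    moreover have "lab' \<in> S \<rightarrow> ?C" using lab lw lv by (auto simp: lab'_def)
    ultimately have IH: "(\<Sum>h\<in>S \<rightarrow>\<^sub>E ?C. \<Prod>u\<in>S. of_bool (h (\<tau> u) = h u \<otimes> lab' u) - 1 / k)
        = (-1) ^ card S * of_int (sign \<tau>)"
      using \<tau> by (intro insert.IH)
    have "(\<Sum>h\<in>insert v S \<rightarrow>\<^sub>E ?C. \<Prod>u\<in>insert v S. of_bool (h (\<sigma> u) = h u \<otimes> lab u) - 1 / k)
        = (\<Sum>h\<in>S \<rightarrow>\<^sub>E ?C. \<Prod>u\<in>S. of_bool (h (\<tau> u) = h u \<otimes> lab' u) - 1 / k)"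
      unfolding sum_PiE_insert[OF insert.hyps(2)]
    proof (rule sum.cong[OF refl])
      fix h assume h: "h \<in> S \<rightarrow>\<^sub>E ?C"
      let ?R = "\<Prod>u\<in>S - {w}. of_bool (h (\<tau> u) = h u \<otimes> lab' u) - 1 / k"
      have hw: "h w \<in> ?C" and hC: "h w \<otimes> lab w \<in> ?C" "h x \<in> ?C" using h w x lw by auto
      have "(\<Prod>u\<in>insert v S. of_bool ((h(v := g)) (\<sigma> u) = (h(v := g)) u \<otimes> lab u) - 1 / k)
          = ((of_bool (g = h w \<otimes> lab w) - 1 / k) * (of_bool (h x = g \<otimes> lab v) - 1 / k)) * ?R" for g
      proof -
        have "(\<Prod>u\<in>S - {w}. of_bool ((h(v := g)) (\<sigma> u) = (h(v := g)) u \<otimes> lab u) - 1 / k) = ?R"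
        proof (rule prod.cong[OF refl])
          fix u assume u: "u \<in> S - {w}"
          then have "u \<noteq> v" using insert.hyps(2) by auto
          with u show "of_bool ((h(v := g)) (\<sigma> u) = (h(v := g)) u \<otimes> lab u) - 1 / k
              = of_bool (h (\<tau> u) = h u \<otimes> lab' u) - 1 / k"
            using \<tau>_other[of u] by (simp add: lab'_def)
        qed
        then show ?thesis
          using insert.hyps w x False \<sigma>w by (simp add: prod.remove[of S w] x_def mult_ac)
      qed
      then have "(\<Sum>g\<in>?C. \<Prod>u\<in>insert v S. of_bool ((h(v := g)) (\<sigma> u) = (h(v := g)) u \<otimes> lab u) - 1 / k)
          = (\<Sum>g\<in>?C. (of_bool (g = h w \<otimes> lab w) - 1 / k) * (of_bool (h x = g \<otimes> lab v) - 1 / k)) * ?R"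
        by (simp only: sum_distrib_right)
      also have "\<dots> = (of_bool (h x = h w \<otimes> lab w \<otimes> lab v) - 1 / k) * ?R"
        by (simp only: kernel_mult[OF hC lv])
      also have "\<dots> = (\<Prod>u\<in>S. of_bool (h (\<tau> u) = h u \<otimes> lab' u) - 1 / k)"
        unfolding prod.remove[OF insert.hyps(1) w(1)]
        using hw lw lv by (simp add: \<tau>w lab'_def m_assoc)
      finally show "(\<Sum>g\<in>?C. \<Prod>u\<in>insert v S. of_bool ((h(v := g)) (\<sigma> u) = (h(v := g)) u \<otimes> lab u) - 1 / k)
          = (\<Prod>u\<in>S. of_bool (h (\<tau> u) = h u \<otimes> lab' u) - 1 / k)" .
    qed
    then show ?thesis using insert.hyps False by (simp add: IH sign)
  qed
qed

text \<open>The constraints along a forest are independent, and those along a cycle are contradictory.\<close>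

lemma sum_potentials_le:
  assumes "finite S" "T \<subseteq> S" "f ` T \<subseteq> S" "lab \<in> T \<rightarrow> carrier G" "no_potential f lab T"
  shows "(\<Sum>h\<in>S \<rightarrow>\<^sub>E carrier G. \<Prod>u\<in>T. of_bool (h (f u) = h u \<otimes> lab u)) \<le> k ^ (card S - card T)"
  using assms
proof (induction "card T" arbitrary: S T)
  case 0
  then have "T = {}" by (metis card_eq_0_iff finite_subset)
  then show ?case using 0 by (simp add: card_funcsetE Coset.order_def)
next
  case (Suc n)
  have finT: "finite T" using Suc.prems finite_subset by blast
  show ?case
  proof (cases "T \<subseteq> f ` T")
    case True
    then have fT: "f ` T = T"
      using finT by (metis card_image_le card_seteq finite_imageI)
    \<comment> \<open>\<open>T\<close> is closed under \<open>f\<close>, so a function meeting all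
      constraints would be a forbidden potential.\<close>
    have "(\<Prod>u\<in>T. of_bool (h (f u) = h u \<otimes> lab u)) = (0::real)" if "h \<in> S \<rightarrow>\<^sub>E carrier G" for h
    proof (rule ccontr)
      assume "\<not> ?thesis"
      then have "potential f lab T h"
        using finT that Suc.prems(2) by (auto simp: potential_def)
      moreover have "T \<noteq> {}" using Suc.hyps(2) by auto
      ultimately show False using no_potentialD[OF Suc.prems(5)] fT by blast
    qed
    then show ?thesis by (simp add: sum.neutral)
  next
    case False
    \<comment> \<open>The value at the leaf \<open>u\<close> occurs only in its own constraint,
      which has exactly one solution. Removing \<open>u\<close> from both sets preserves
      \<open>card S - card T\<close>.\<close>
    then obtain u where u: "u \<in> T" "u \<notin> f ` T" by blast
    define S' T' where "S' = S - {u}" and "T' = T - {u}"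
    have S: "S = insert u S'" "u \<notin> S'" and T: "T = insert u T'" "u \<notin> T'"
      using u Suc.prems(2) by (auto simp: S'_def T'_def)
    have fin': "finite S'" "finite T'" using Suc.prems(1) finT by (auto simp: S'_def T'_def)
    have "f u \<noteq> u" using u by force
    then have fu: "f u \<in> S'" using u Suc.prems(3) by (auto simp: S'_def)
    have lab: "lab u \<in> carrier G" using u Suc.prems(4) by auto
    have "(\<Sum>h\<in>S \<rightarrow>\<^sub>E carrier G. \<Prod>u\<in>T. of_bool (h (f u) = h u \<otimes> lab u))
        = (\<Sum>h\<in>S' \<rightarrow>\<^sub>E carrier G. \<Prod>u\<in>T'. of_bool (h (f u) = h u \<otimes> lab u) :: real)"
      unfolding S(1) sum_PiE_insert[OF S(2)]
    proof (rule sum.cong[OF refl])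
      fix h assume h: "h \<in> S' \<rightarrow>\<^sub>E carrier G"
      have "(\<Prod>w\<in>T. of_bool ((h(u := g)) (f w) = (h(u := g)) w \<otimes> lab w))
          = of_bool (h (f u) = g \<otimes> lab u) * (\<Prod>w\<in>T'. of_bool (h (f w) = h w \<otimes> lab w) :: real)" for g
      proof -
        have "(\<Prod>w\<in>T'. of_bool ((h(u := g)) (f w) = (h(u := g)) w \<otimes> lab w))
            = (\<Prod>w\<in>T'. of_bool (h (f w) = h w \<otimes> lab w) :: real)"
        proof (rule prod.cong[OF refl])
          fix w assume "w \<in> T'"
          then have "w \<noteq> u" "f w \<noteq> u" using u by (auto simp: T'_def)
          then show "of_bool ((h(u := g)) (f w) = (h(u := g)) w \<otimes> lab w)
              = (of_bool (h (f w) = h w \<otimes> lab w) :: real)" by simp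
        qed
        then show ?thesis unfolding T(1) using fin' T(2) \<open>f u \<noteq> u\<close> by simp
      qed
      then have "(\<Sum>g\<in>carrier G. \<Prod>w\<in>T. of_bool ((h(u := g)) (f w) = (h(u := g)) w \<otimes> lab w))
          = (\<Sum>g\<in>carrier G. of_bool (h (f u) = g \<otimes> lab u)) * (\<Prod>w\<in>T'. of_bool (h (f w) = h w \<otimes> lab w) :: real)"
        by (simp only: sum_distrib_right)
      moreover have "h (f u) \<in> carrier G" using h fu by auto
      ultimately show "(\<Sum>g\<in>carrier G. \<Prod>w\<in>T. of_bool ((h(u := g)) (f w) = (h(u := g)) w \<otimes> lab w))
          = (\<Prod>w\<in>T'. of_bool (h (f w) = h w \<otimes> lab w) :: real)"
        using sum_of_bool_eq_mult[of "h (f u)" "lab u"] lab by simp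
    qed
    also have "\<dots> \<le> k ^ (card S' - card T')"
    proof (rule Suc.hyps(1))
      show "n = card T'" using Suc.hyps(2) u finT by (simp add: T'_def)
      show "f ` T' \<subseteq> S'" using u Suc.prems(3) by (auto simp: S'_def T'_def)
      show "no_potential f lab T'"
        using Suc.prems(5) by (rule no_potential_subset) (auto simp: T'_def)
    qed (use fin' Suc.prems in \<open>auto simp: S'_def T'_def\<close>)
    also have "card S' - card T' = card S - card T"
      using fin' S T by simp
    finally show ?thesis .
  qed
qed

text \<open>A squared kernel is \<open>\<beta> * of_bool b + \<gamma>\<close> with
  \<open>\<beta> \<ge> 0\<close> as \<open>k \<ge> 2\<close>, so after expansion each set of
  constraints can be bounded separately. The result is the value for fully independent
  constraints.\<close>

lemma sum_kernel_squares_le: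
  assumes "finite S" "f ` S \<subseteq> S" "lab \<in> S \<rightarrow> carrier G" "no_potential f lab S" "2 \<le> order G"
  shows "(\<Sum>h\<in>S \<rightarrow>\<^sub>E carrier G. \<Prod>u\<in>S. (of_bool (h (f u) = h u \<otimes> lab u) - 1 / k)\<^sup>2)
    \<le> ((k - 1) / k) ^ card S"
proof -
  define \<beta> \<gamma> where "\<beta> = 1 - 2 / k" and "\<gamma> = 1 / k\<^sup>2"
  have nonneg: "0 \<le> \<beta>" "0 \<le> \<gamma>" using assms(5) by (auto simp: \<beta>_def \<gamma>_def field_simps)
  have sq: "(of_bool b - 1 / k)\<^sup>2 = \<beta> * of_bool b + \<gamma>" for b
    by (cases b) (auto simp: \<beta>_def \<gamma>_def power2_eq_square algebra_simps)
  have "(\<Sum>h\<in>S \<rightarrow>\<^sub>E carrier G. \<Prod>u\<in>S. (of_bool (h (f u) = h u \<otimes> lab u) - 1 / k)\<^sup>2)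
      = (\<Sum>h\<in>S \<rightarrow>\<^sub>E carrier G. \<Sum>T\<in>Pow S.
          (\<Prod>u\<in>T. \<beta> * of_bool (h (f u) = h u \<otimes> lab u)) * (\<Prod>u\<in>S - T. \<gamma>))"
    unfolding sq prod_add[OF assms(1)] ..
  also have "\<dots> = (\<Sum>T\<in>Pow S. \<beta> ^ card T * \<gamma> ^ card (S - T)
      * (\<Sum>h\<in>S \<rightarrow>\<^sub>E carrier G. \<Prod>u\<in>T. of_bool (h (f u) = h u \<otimes> lab u)))"
    by (subst sum.swap) (simp add: prod.distrib sum_distrib_left mult_ac)
  also have "\<dots> \<le> (\<Sum>T\<in>Pow S. \<beta> ^ card T * \<gamma> ^ card (S - T) * k ^ (card S - card T))"
  proof (intro sum_mono mult_left_mono sum_potentials_le)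
    fix T assume "T \<in> Pow S"
    then show "no_potential f lab T" "lab \<in> T \<rightarrow> carrier G" "f ` T \<subseteq> S" "T \<subseteq> S"
      using no_potential_subset[OF assms(4)] assms(2,3) by auto
  qed (use assms(1) nonneg in auto)
  also have "\<dots> = (\<Sum>T\<in>Pow S. (\<Prod>u\<in>T. \<beta>) * (\<Prod>u\<in>S - T. k * \<gamma>))"
  proof (intro sum.cong refl)
    fix T assume "T \<in> Pow S"
    then have "card S - card T = card (S - T)"
      using assms(1) by (simp add: card_Diff_subset finite_subset)
    then show "\<beta> ^ card T * \<gamma> ^ card (S - T) * k ^ (card S - card T) = (\<Prod>u\<in>T. \<beta>) * (\<Prod>u\<in>S - T. k * \<gamma>)"
      by (simp add: power_mult_distrib)
  qed
  also have "\<dots> = (\<Prod>u\<in>S. \<beta> + k * \<gamma>)" by (simp only: prod_add[OF assms(1)])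
  also have "\<beta> + k * \<gamma> = (k - 1) / k"
    using k_pos by (simp add: \<beta>_def \<gamma>_def field_simps power2_eq_square)
  finally show ?thesis by simp
qed

end

end

section \<open>The permanent of a digraph without zero-sum cycles\<close>

text \<open>\<open>no_pot\<close> speaks of all maps along \<open>adj\<close>, not just
  permutations: the product of row norms in Hadamard's inequality expands into arbitrary
  functions.\<close>

lemma (in group) permanent_upper_bound:
  fixes lab :: "'v \<Rightarrow> 'v \<Rightarrow> 'a"
  assumes fin: "finite (carrier G)" and order: "2 \<le> order G" and S: "finite S"
    and lab: "\<And>u v. adj u v \<Longrightarrow> lab u v \<in> carrier G"
    and no_pot: "\<And>f. f ` S \<subseteq> S \<Longrightarrow> (\<And>u. u \<in> S \<Longrightarrow> adj u (f u)) \<Longrightarrow> no_potential f (\<lambda>u. lab u (f u)) S"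
  shows "(permanent S (\<lambda>u v. of_bool (adj u v)))\<^sup>2
    \<le> (\<Prod>u\<in>S. (real (order G) - 1) * real (card {v\<in>S. adj u v}))"
proof -
  let ?k = "real (order G)" and ?H = "S \<rightarrow>\<^sub>E carrier G"
  define ker where "ker h u v = (of_bool (h v = h u \<otimes> lab u v) - 1 / ?k)" for h u v
  define M where "M h u v = of_bool (adj u v) * ker h u v" for h u v
  define D where "D h = (\<Sum>p | p permutes S. of_int (sign p) * (\<Prod>u\<in>S. M h u (p u)))" for h
  have k: "0 < ?k" using k_pos[OF fin] .
  have finH: "finite ?H" using S fin by (intro finite_PiE) auto
  have cardH: "real (card ?H) = ?k ^ card S" using S by (simp add: card_funcsetE Coset.order_def)
  have "(\<Sum>h\<in>?H. D h)
      = (\<Sum>p | p permutes S. of_int (sign p) * (\<Sum>h\<in>?H. \<Prod>u\<in>S. M h u (p u)))"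
    unfolding D_def by (subst sum.swap) (simp add: sum_distrib_left)
  also have "\<dots> = (\<Sum>p | p permutes S. (-1) ^ card S * (\<Prod>u\<in>S. of_bool (adj u (p u))))"
  proof (intro sum.cong refl)
    fix p assume "p \<in> {p. p permutes S}"
    then have p: "p permutes S" by simp
    show "of_int (sign p) * (\<Sum>h\<in>?H. \<Prod>u\<in>S. M h u (p u)) = (-1) ^ card S * (\<Prod>u\<in>S. of_bool (adj u (p u)))"
    proof (cases "\<forall>u\<in>S. adj u (p u)")
      case True
      have "no_potential p (\<lambda>u. lab u (p u)) S"
        using True permutes_image[OF p] by (intro no_pot) auto
      then have "(\<Sum>h\<in>?H. \<Prod>u\<in>S. ker h u (p u)) = (-1) ^ card S * of_int (sign p)"
        unfolding ker_def using True lab by (intro sum_kernels_permutation[OF fin S p]) auto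
      moreover have "(\<Sum>h\<in>?H. \<Prod>u\<in>S. M h u (p u)) = (\<Sum>h\<in>?H. \<Prod>u\<in>S. ker h u (p u))"
        using True by (intro sum.cong prod.cong refl) (simp add: M_def)
      \<comment> \<open>The sign in the determinant cancels the sign from the kernel sum, leaving an
        unsigned permanent.\<close>
      moreover have "(of_int (sign p) * of_int (sign p) :: real) = 1"
        by (simp flip: of_int_mult)
      ultimately show ?thesis using True by (simp add: mult_ac)
    next
      case False
      then have "(\<Prod>u\<in>S. of_bool (adj u (p u))) = (0::real)" "(\<Prod>u\<in>S. M h u (p u)) = 0" for h
        using S by (auto simp: M_def prod_zero_iff)
      then show ?thesis by simp
    qed
  qed
  also have "\<dots> = (-1) ^ card S * permanent S (\<lambda>u v. of_bool (adj u v))"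
    by (simp only: permanent_def sum_distrib_left)
  finally have "(permanent S (\<lambda>u v. of_bool (adj u v)))\<^sup>2 = (\<Sum>h\<in>?H. 1 * D h)\<^sup>2"
    by (simp add: power_mult_distrib power_even_eq[symmetric])
  also have "\<dots> \<le> (\<Sum>h\<in>?H. 1\<^sup>2) * (\<Sum>h\<in>?H. (D h)\<^sup>2)" by (rule Cauchy_Schwarz_ineq_sum)
  also have "\<dots> = ?k ^ card S * (\<Sum>h\<in>?H. (D h)\<^sup>2)" by (simp add: cardH)
  also have "(\<Sum>h\<in>?H. (D h)\<^sup>2) \<le> (\<Sum>h\<in>?H. \<Prod>u\<in>S. \<Sum>v\<in>S. (M h u v)\<^sup>2)"
    unfolding D_def by (intro sum_mono hadamard S)
  also have "\<dots> = (\<Sum>h\<in>?H. \<Prod>u\<in>S. \<Sum>v\<in>{v\<in>S. adj u v}. (ker h u v)\<^sup>2)"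
    using S by (intro sum.cong prod.cong refl sum.mono_neutral_cong_right) (auto simp: M_def)
  also have "\<dots> = (\<Sum>h\<in>?H. \<Sum>f\<in>(\<Pi>\<^sub>E u\<in>S. {v\<in>S. adj u v}). \<Prod>u\<in>S. (ker h u (f u))\<^sup>2)"
    using S by (intro sum.cong refl prod_sum_PiE) auto
  also have "\<dots> = (\<Sum>f\<in>(\<Pi>\<^sub>E u\<in>S. {v\<in>S. adj u v}). \<Sum>h\<in>?H. \<Prod>u\<in>S. (ker h u (f u))\<^sup>2)"
    by (rule sum.swap)
  also have "\<dots> \<le> (\<Sum>f\<in>(\<Pi>\<^sub>E u\<in>S. {v\<in>S. adj u v}). ((?k - 1) / ?k) ^ card S)"
  proof (intro sum_mono)
    fix f assume f: "f \<in> (\<Pi>\<^sub>E u\<in>S. {v\<in>S. adj u v})"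
    then have "f u \<in> S" "adj u (f u)" if "u \<in> S" for u using that by (auto dest: PiE_mem)
    then show "(\<Sum>h\<in>?H. \<Prod>u\<in>S. (ker h u (f u))\<^sup>2) \<le> ((?k - 1) / ?k) ^ card S"
      unfolding ker_def using lab by (intro sum_kernel_squares_le[OF fin S] no_pot order) auto
  qed
  also have "\<dots> = (\<Prod>u\<in>S. real (card {v\<in>S. adj u v})) * ((?k - 1) / ?k) ^ card S"
    using S by (simp add: card_PiE)
  finally have "(permanent S (\<lambda>u v. of_bool (adj u v)))\<^sup>2
      \<le> ?k ^ card S * ((\<Prod>u\<in>S. real (card {v\<in>S. adj u v})) * ((?k - 1) / ?k) ^ card S)"
    using k by (simp add: mult_left_mono)
  also have "\<dots> = (\<Prod>u\<in>S. (?k - 1) * real (card {v\<in>S. adj u v}))"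
    using k by (simp add: prod.distrib power_divide)
  finally show ?thesis .
qed

text \<open>\<open>X\<close> is the set where the diagonal entry is chosen; its term vanishes unless
  the permutation fixes \<open>X\<close> pointwise.\<close>

lemma permanent_add_diag:
  assumes "finite V"
  shows "permanent V (\<lambda>v u. (if u = v then c v else 0) + a v u)
    = (\<Sum>X\<in>Pow V. (\<Prod>v\<in>X. c v) * permanent (V - X) a)"
proof -
  have finP: "finite {p. p permutes V}" using assms by (rule finite_permutations)
  have "permanent V (\<lambda>v u. (if u = v then c v else 0) + a v u)
      = (\<Sum>X\<in>Pow V. \<Sum>p | p permutes V. (\<Prod>v\<in>X. if p v = v then c v else 0) * (\<Prod>v\<in>V - X. a v (p v)))"
    unfolding permanent_def prod_add[OF assms] by (rule sum.swap)
  also have "\<dots> = (\<Sum>X\<in>Pow V. (\<Prod>v\<in>X. c v) * permanent (V - X) a)"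
    unfolding permanent_def sum_distrib_left
  proof (intro sum.cong[OF refl] sum.mono_neutral_cong_right[OF finP])
    fix X assume X: "X \<in> Pow V"
    then have finX: "finite X" using assms finite_subset by blast
    show "{p. p permutes V - X} \<subseteq> {p. p permutes V}" by (auto intro: permutes_subset)
    show "\<forall>p\<in>{p. p permutes V} - {p. p permutes V - X}.
        (\<Prod>v\<in>X. if p v = v then c v else 0) * (\<Prod>v\<in>V - X. a v (p v)) = 0"
    proof
      fix p assume p: "p \<in> {p. p permutes V} - {p. p permutes V - X}"
      then obtain v where "v \<in> X" "p v \<noteq> v" using permutes_superset[of p V "V - X"] by auto
      then have "(\<Prod>v\<in>X. if p v = v then c v else 0) = 0" using finX by (auto simp: prod_zero_iff)
      then show "(\<Prod>v\<in>X. if p v = v then c v else 0) * (\<Prod>v\<in>V - X. a v (p v)) = 0" by simp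
    qed
    fix p assume "p \<in> {p. p permutes V - X}"
    then have "p v = v" if "v \<in> X" for v using that by (auto intro: permutes_not_in)
    then show "(\<Prod>v\<in>X. if p v = v then c v else 0) * (\<Prod>v\<in>V - X. a v (p v))
        = (\<Prod>v\<in>X. c v) * (\<Prod>v\<in>V - X. a v (p v))" by simp
  qed
  finally show ?thesis .
qed

section \<open>Zero-sum cycles\<close>

lemma (in wf_digraph) ex_cycle_if_successors:
  assumes "finite (verts G)" "verts G \<noteq> {}"
    and e: "\<And>u. u \<in> verts G \<Longrightarrow> e u \<in> arcs G \<and> tail G (e u) = u"
  shows "\<exists>p. cycle p"
proof -
  define f where "f u = head G (e u)" for u
  have f: "f u \<in> verts G" if "u \<in> verts G" for u using e[OF that] by (simp add: f_def)
  have walk: "\<exists>p. awalk u p ((f ^^ n) u) \<and> length p = n" if "u \<in> verts G" for u n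
    using that
  proof (induction n arbitrary: u)
    case 0
    then show ?case by (simp add: awalk_Nil_iff)
  next
    case (Suc n)
    obtain p where "awalk (f u) p ((f ^^ n) (f u))" "length p = n" using Suc.IH[OF f[OF Suc.prems]] by blast
    then have "awalk u (e u # p) ((f ^^ Suc n) u) \<and> length (e u # p) = Suc n"
      using e[OF Suc.prems] by (simp add: awalk_Cons_iff f_def funpow_swap1)
    then show ?case by blast
  qed
  obtain u0 where u0: "u0 \<in> verts G" using assms(2) by blast
  have iter: "(f ^^ i) u0 \<in> verts G" for i using u0 f by (induction i) auto
  then have "range (\<lambda>i. (f ^^ i) u0) \<subseteq> verts G" by blast
  then have "\<not> inj (\<lambda>i. (f ^^ i) u0)"
    using assms(1) by (metis finite_imageD finite_subset infinite_UNIV_nat)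
  then obtain i j where ij: "i < j" "(f ^^ i) u0 = (f ^^ j) u0"
    unfolding inj_def by (metis linorder_neqE_nat)
  have "(f ^^ (j - i)) ((f ^^ i) u0) = (f ^^ (j - i + i)) u0" by (simp only: funpow_add o_apply)
  also have "\<dots> = (f ^^ i) u0" using ij by simp
  finally have "(f ^^ (j - i)) ((f ^^ i) u0) = (f ^^ i) u0" .
  moreover obtain p where "awalk ((f ^^ i) u0) p ((f ^^ (j - i)) ((f ^^ i) u0))" "length p = j - i"
    using walk[OF iter] by blast
  ultimately have "closed_w p" using ij by (auto simp: closed_w_def)
  then show ?thesis by (rule closed_w_imp_cycle)
qed

lemma (in group) label_product_closed:
  "w ` set p \<subseteq> carrier G \<Longrightarrow> label_product G w p \<in> carrier G"
  by (induction p) (auto simp: label_product_def)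

lemma (in group) potential_imp_zero_sum_cycle:
  assumes D: "wf_digraph D" and T: "finite T" "T \<noteq> {}" "f ` T \<subseteq> T"
    and e: "\<And>u. u \<in> T \<Longrightarrow> e u \<in> arcs D \<and> tail D (e u) = u \<and> head D (e u) = f u"
    and w: "\<And>x. x \<in> arcs D \<Longrightarrow> w x \<in> carrier G"
    and pot: "potential f (\<lambda>u. w (e u)) T h"
  shows "\<exists>p. zero_sum_cycle G D w p"
proof -
  interpret D: wf_digraph D by (rule D)
  \<comment> \<open>In the subdigraph of the chosen arcs every cycle follows \<open>f\<close>, so
    the potential applies to it.\<close>
  define D' where "D' = \<lparr>verts = T, arcs = e ` T, tail = tail D, head = head D\<rparr>"
  interpret D': wf_digraph D' using e T(3) by unfold_locales (auto simp: D'_def)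
  obtain p where "D'.cycle p"
    using D'.ex_cycle_if_successors[of e] e T by (auto simp: D'_def)
  then obtain u where walk: "D'.awalk u p u" and dist: "distinct (tl (D'.awalk_verts u p))" "p \<noteq> []"
    unfolding D'.cycle_def by blast
  have ends: "tail D' = tail D" "head D' = head D" by (simp_all add: D'_def)
  have verts_eq: "D'.awalk_verts u p = D.awalk_verts u p" for u p
    by (induction p arbitrary: u) (simp_all add: ends)
  have cas_eq: "D'.cas u p v = D.cas u p v" for u p v
    by (induction u p v rule: D.cas.induct) (simp_all add: ends)
  have u: "u \<in> T" and arcs: "set p \<subseteq> e ` T" and cas: "D.cas u p u"
    using walk unfolding D'.awalk_def cas_eq by (simp_all add: D'_def)
  have "T \<subseteq> verts D" using e D.tail_in_verts by (metis subsetI)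
  then have cycle: "D.cycle p"
    unfolding D.cycle_def D.awalk_def using u arcs cas dist e by (force simp: verts_eq)
  \<comment> \<open>Along a walk of chosen arcs the potential telescopes; on a closed walk,
    cancelling \<open>h u\<close> leaves a trivial product.\<close>
  have "h v = h u \<otimes> label_product G w p" if "set p \<subseteq> e ` T" "D.cas u p v" "u \<in> T" for u v p
    using that
  proof (induction p arbitrary: u)
    case Nil
    then show ?case using pot by (auto simp: label_product_def potential_def Pi_iff)
  next
    case (Cons x p)
    then obtain u' where "u' \<in> T" "x = e u'" by auto
    then have x: "x = e u" "head D x = f u" using e[of u'] Cons.prems by auto
    have fu: "f u \<in> T" using T(3) Cons.prems by auto
    have wp: "w x \<in> carrier G" "w ` set p \<subseteq> carrier G" using Cons.prems(1) e w by auto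
    have "h v = h (f u) \<otimes> label_product G w p"
      using Cons.prems fu x by (intro Cons.IH) auto
    also have "h (f u) = h u \<otimes> w x" using pot Cons.prems x by (auto simp: potential_def)
    also have "h u \<otimes> w x \<otimes> label_product G w p = h u \<otimes> (w x \<otimes> label_product G w p)"
      using pot Cons.prems wp label_product_closed[OF wp(2)] by (intro m_assoc) (auto simp: potential_def)
    finally show ?case by (simp add: label_product_def)
  qed
  from this[OF arcs cas u] have "h u = h u \<otimes> label_product G w p" .
  moreover have "h u \<in> carrier G" using pot u by (auto simp: potential_def)
  moreover have "w ` set p \<subseteq> carrier G" using arcs e w by auto
  ultimately have "label_product G w p = \<one>"
    using label_product_closed[of w p] by simp
  with cycle show ?thesis unfolding zero_sum_cycle_def by blast
qed

theorem theorem5p1: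
  fixes \<Gamma> :: "('g, 'm) monoid_scheme"
    and k :: nat
    and D :: "('a, 'b) pre_digraph"
    and w :: "'b \<Rightarrow> 'g"
  assumes "group \<Gamma>"
    and "finite (carrier \<Gamma>)"
    and "order \<Gamma> = k"
    and "k \<ge> 2"
    and "digraph D"
    and "verts D \<noteq> {}"
    and "eulerian D"
    and "\<And>a. a \<in> arcs D \<Longrightarrow> w a \<in> carrier \<Gamma>"
    and "max_deg D > 0"
    and "real (min_deg D) ^ 3 / real (max_deg D) ^ 2 \<ge> exp 1 ^ 3 * (real k - 1)"
  shows "\<exists>p. zero_sum_cycle \<Gamma> D w p"
proof (rule ccontr)
  assume no_cycle: "\<not> ?thesis"
  interpret group \<Gamma> by (rule assms(1))
  interpret D: digraph D by (rule assms(5))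
  let ?V = "verts D"
  define adj where "adj u v \<longleftrightarrow> (\<exists>x\<in>arcs D. tail D x = u \<and> head D x = v)" for u v
  define arc where "arc u v = (SOME x. x \<in> arcs D \<and> tail D x = u \<and> head D x = v)" for u v
  have arc: "arc u v \<in> arcs D" "tail D (arc u v) = u" "head D (arc u v) = v" if "adj u v" for u v
    using that someI_ex[of "\<lambda>x. x \<in> arcs D \<and> tail D x = u \<and> head D x = v"]
    unfolding adj_def arc_def by blast+
  have unique: "x = y" if "x \<in> arcs D" "y \<in> arcs D" "tail D x = tail D y" "head D x = head D y" for x y
    using that D.no_multi_arcs by (auto simp: arc_to_ends_def)
  define d where "d v = real (out_degree D v)" for v
  define \<Delta> \<delta> m where "\<Delta> = real (max_deg D)" and "\<delta> = real (min_deg D)" and "m = real k - 1"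
  have m: "0 < m" using assms(4) by (simp add: m_def)
  have \<Delta>: "0 < \<Delta>" using assms(9) by (simp add: \<Delta>_def)
  have bound: "exp 1 ^ 3 * m * \<Delta>\<^sup>2 \<le> \<delta> ^ 3"
    using assms(10) \<Delta> by (simp add: m_def \<Delta>_def \<delta>_def field_simps)
  have \<delta>: "0 < \<delta>"
  proof (rule ccontr)
    assume "\<not> 0 < \<delta>"
    then have "\<delta> ^ 3 = 0" by (simp add: \<delta>_def)
    moreover have "0 < exp 1 ^ 3 * m * \<Delta>\<^sup>2" using m \<Delta> by simp
    ultimately show False using bound by simp
  qed
  have d: "\<delta> \<le> d v" "d v \<le> \<Delta>" if "v \<in> ?V" for v
    using that by (auto simp: d_def \<delta>_def \<Delta>_def min_deg_def max_deg_def)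
  have d_pos: "0 < d v" if "v \<in> ?V" for v using d(1)[OF that] \<delta> by simp
  have out: "card {v\<in>?V. adj u v} = out_degree D u" for u
  proof -
    have "bij_betw (head D) (out_arcs D u) {v\<in>?V. adj u v}"
      by (rule bij_betw_imageI) (auto simp: inj_on_def adj_def intro: unique)
    then show ?thesis unfolding out_degree_def by (metis bij_betw_same_card)
  qed
  have "card {u\<in>?V. adj u v} = in_degree D v" for v
  proof -
    have "bij_betw (tail D) (in_arcs D v) {u\<in>?V. adj u v}"
      by (rule bij_betw_imageI) (auto simp: inj_on_def adj_def intro: unique)
    then show ?thesis unfolding in_degree_def by (metis bij_betw_same_card)
  qed
  then have inn: "card {u\<in>?V. adj u v} = out_degree D v" if "v \<in> ?V" for v
    using assms(7) that by (simp add: eulerian_def)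
  define a where "a u v = (of_bool (adj u v) :: real)" for u v
  have row: "(\<Sum>v\<in>?V. a u v) = d u" for u
    by (simp add: a_def d_def out[symmetric] of_bool_def sum.If_cases Int_def)
  have col: "(\<Sum>u\<in>?V. a u v) = d v" if "v \<in> ?V" for v
    by (simp add: a_def d_def inn[OF that, symmetric] of_bool_def sum.If_cases Int_def)
  have no_pot: "no_potential f (\<lambda>u. w (arc u (f u))) S"
    if S: "S \<subseteq> ?V" and edges: "\<And>u. u \<in> S \<Longrightarrow> adj u (f u)" for f S
    unfolding no_potential_def
  proof (intro allI impI notI)
    fix T h assume T: "T \<subseteq> S \<and> T \<noteq> {} \<and> f ` T \<subseteq> T" and pot: "potential f (\<lambda>u. w (arc u (f u))) T h"
    have "finite T" using T S D.finite_verts by (meson finite_subset)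
    moreover have "arc u (f u) \<in> arcs D \<and> tail D (arc u (f u)) = u \<and> head D (arc u (f u)) = f u"
      if "u \<in> T" for u
    proof -
      have "adj u (f u)" using T that by (intro edges) auto
      then show ?thesis by (simp add: arc)
    qed
    ultimately have "\<exists>p. zero_sum_cycle \<Gamma> D w p"
      using T by (intro potential_imp_zero_sum_cycle[OF D.wf_digraph _ _ _ _ assms(8) pot]) simp_all
    then show False using no_cycle by blast
  qed
  define R where "R v = sqrt (m * d v)" for v
  \<comment> \<open>What is left of \<open>d v / e\<close> after the least admissible diagonal
    entry.\<close>
  define R' where "R' v = d v / \<Delta> * (d v / exp 1)" for v
  have upper: "permanent S a \<le> (\<Prod>v\<in>S. R v)" if S: "S \<subseteq> ?V" for S
  proof (rule power2_le_imp_le)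
    have finS: "finite S" using S D.finite_verts by (rule finite_subset)
    have "(permanent S a)\<^sup>2 \<le> (\<Prod>u\<in>S. m * real (card {v\<in>S. adj u v}))"
      using permanent_upper_bound[of S adj "\<lambda>u v. w (arc u v)"] no_pot[OF S] arc(1) finS assms(2-4,8)
      by (simp add: a_def[abs_def] m_def)
    also have "\<dots> \<le> (\<Prod>u\<in>S. m * d u)"
    proof (intro prod_mono conjI mult_left_mono)
      fix u assume "u \<in> S"
      have "card {v\<in>S. adj u v} \<le> card {v\<in>?V. adj u v}" using S by (intro card_mono) auto
      then show "real (card {v\<in>S. adj u v}) \<le> d u" by (simp add: d_def out)
    qed (use m in auto)
    also have "\<dots> = (\<Prod>u\<in>S. R u)\<^sup>2"
      unfolding R_def prod_power_distrib using m by (intro prod.cong refl) (simp add: d_def)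
    finally show "(permanent S a)\<^sup>2 \<le> (\<Prod>v\<in>S. R v)\<^sup>2" .
    show "0 \<le> (\<Prod>v\<in>S. R v)" unfolding R_def using m by (intro prod_nonneg) (simp add: d_def)
  qed
  have R: "R v < R' v" if v: "v \<in> ?V" for v
  proof (rule power2_less_imp_less)
    \<comment> \<open>The squared goal is \<open>e^2 * m * \<Delta>^2 * d v < (d v)^4\<close>; the
      further factor \<open>e > 1\<close> in \<open>bound\<close> makes it strict.\<close>
    have "exp 1 ^ 3 * m * \<Delta>\<^sup>2 \<le> d v ^ 3"
      using bound power_mono[OF d(1)[OF v], of 3] \<delta> by simp
    then have "exp 1 * (exp 1)\<^sup>2 * m * \<Delta>\<^sup>2 * d v \<le> d v ^ 3 * d v"
      using d_pos[OF v] by (intro mult_right_mono) (simp_all add: power3_eq_cube power2_eq_square)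
    moreover have "1 * ((exp 1)\<^sup>2 * m * \<Delta>\<^sup>2 * d v) < exp 1 * ((exp 1)\<^sup>2 * m * \<Delta>\<^sup>2 * d v)"
      using m \<Delta> d_pos[OF v] by (intro mult_strict_right_mono) (auto intro!: mult_pos_pos)
    ultimately have "(exp 1)\<^sup>2 * m * \<Delta>\<^sup>2 * d v < d v ^ 4"
      by (simp add: mult_ac eval_nat_numeral)
    then show "(R v)\<^sup>2 < (R' v)\<^sup>2"
      using m \<Delta> d_pos[OF v] by (simp add: R_def R'_def field_simps eval_nat_numeral)
    show "0 \<le> R' v" using \<Delta> d_pos[OF v] by (simp add: R'_def)
  qed
  \<comment> \<open>The midpoint between the least admissible entry \<open>d v / e - R' v\<close>
    and \<open>d v / e - R v\<close>. It is positive even if \<open>d v = \<Delta>\<close>, and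
    still \<open>c v + R v < d v / e\<close>.\<close>
  define c where "c v = (1 - d v / \<Delta>) * (d v / exp 1) + (R' v - R v) / 2" for v
  have c: "0 < c v" "(1 - d v / \<Delta>) * (d v / exp 1) \<le> c v" if v: "v \<in> ?V" for v
  proof -
    have "0 \<le> (1 - d v / \<Delta>) * (d v / exp 1)"
      using d(2)[OF v] \<Delta> by (intro mult_nonneg_nonneg) (auto simp: d_def)
    moreover have "0 < (R' v - R v) / 2" using R[OF v] by simp
    ultimately show "0 < c v" "(1 - d v / \<Delta>) * (d v / exp 1) \<le> c v"
      unfolding c_def by (rule add_nonneg_pos, simp)
  qed
  have "(\<Prod>v\<in>?V. d v / exp 1) \<le> permanent ?V (\<lambda>v u. (if u = v then c v else 0) + a v u)"
    using row col d d_pos c by (intro permanent_lower_bound[where \<Delta> = \<Delta>]) (auto simp: a_def)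
  also have "\<dots> = (\<Sum>X\<in>Pow ?V. (\<Prod>v\<in>X. c v) * permanent (?V - X) a)"
    by (rule permanent_add_diag) simp
  also have "\<dots> \<le> (\<Sum>X\<in>Pow ?V. (\<Prod>v\<in>X. c v) * (\<Prod>v\<in>?V - X. R v))"
    using c(1) by (intro sum_mono mult_left_mono upper prod_nonneg) (auto simp: less_imp_le)
  also have "\<dots> = (\<Prod>v\<in>?V. c v + R v)" by (simp only: prod_add[OF D.finite_verts])
  also have "\<dots> < (\<Prod>v\<in>?V. d v / exp 1)"
  proof -
    have "c v + R v < d v / exp 1" if v: "v \<in> ?V" for v
    proof -
      have eq: "c v + R v = d v / exp 1 - (R' v - R v) / 2"
        using \<Delta> by (simp add: c_def R'_def field_simps)
      show ?thesis unfolding eq using R[OF v] by simp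
    qed
    moreover have "0 < c v + R v" if "v \<in> ?V" for v
      using c(1)[OF that] m by (simp add: R_def d_def add_pos_nonneg)
    moreover obtain v where "v \<in> ?V" using assms(6) by blast
    ultimately show ?thesis
      using d_pos by (intro prod_mono_strict[of v]) (auto simp: less_imp_le)
  qed
  finally show False by simp
qed

end
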